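(* Let $I$ be a Dixmier ideal in a $C^*$-algebra $A$, let $n \geq 1$ be a natural number, and let $J$ be a Dixmier ideal in $A$ such that $J^n = I$. Then $J = I^{\frac{1}{n}}$.
   Context: $C^*$-algebras are not assumed unital, and $A_+$ denotes the set of positive elements of $A$. An ideal in $A$ is an additive subgroup $I \subseteq A$ with $aI \cup Ia \subseteq I$ for all $a \in A$, not assumed norm-closed; put $I_+ := I \cap A_+$. An order ideal in $A_+$ is an additive submonoid $M \subseteq A_+$ such that $a,b \in A_+$, $a \leq b$ and $b \in M$ imply $a \in M$; it is strongly invariant if for all $x \in A$, $x^*x \in M$ if and only if $xx^* \in M$. A Dixmier ideal in $A$ is a two-sided ideal $I$ (not necessarily norm-closed) that is positively spanned ($I$ is the complex linear span of $I_+$), hereditary ($I_+$ is an order ideal), and such that $I_+$ is strongly invariant. For a Dixmier ideal $I$ and $s \in (0,\infty)$, $I^s$ is the complex linear span of $\{a^s : a \in I_+\}$. (For a Dixmier ideal and a positive integer $s = n$, this agrees with the additive subgroup generated by all products $x_1\cdots x_n$ with $x_1,\ldots,x_n \in I$.) *)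

theory Defs
  imports "HOL-Analysis.Analysis" "HOL-Computational_Algebra.Polynomial"
begin

(* No unit is required; real_normed_algebra supplies submultiplicativity of the norm. *)
class cstar_algebra = real_normed_algebra + complete_space +
  fixes scaleC :: "complex \<Rightarrow> 'a \<Rightarrow> 'a"  (infixr "*\<^sub>C" 75)
    and star :: "'a \<Rightarrow> 'a"
  assumes scaleC_add_right: "c *\<^sub>C (x + y) = c *\<^sub>C x + c *\<^sub>C y"
    and scaleC_add_left: "(c + d) *\<^sub>C x = c *\<^sub>C x + d *\<^sub>C x"
    and scaleC_scaleC: "c *\<^sub>C (d *\<^sub>C x) = (c * d) *\<^sub>C x"
    and scaleC_of_real: "complex_of_real r *\<^sub>C x = r *\<^sub>R x"
    and mult_scaleC_left: "(c *\<^sub>C x) * y = c *\<^sub>C (x * y)"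
    and mult_scaleC_right: "x * (c *\<^sub>C y) = c *\<^sub>C (x * y)"
    and norm_scaleC: "norm (c *\<^sub>C x) = cmod c * norm x"
    and star_add: "star (x + y) = star x + star y"
    and star_scaleC: "star (c *\<^sub>C x) = cnj c *\<^sub>C star x"
    and star_mult: "star (x * y) = star y * star x"
    and star_star: "star (star x) = x"
    and cstar_identity: "norm (star x * x) = (norm x)\<^sup>2"

interpretation cvec: vector_space "scaleC :: complex \<Rightarrow> 'a \<Rightarrow> 'a::cstar_algebra"
proof
  fix x :: 'a
  show "1 *\<^sub>C x = x"
    using scaleC_of_real[of 1 x] by simp
qed (simp_all add: scaleC_add_right scaleC_add_left scaleC_scaleC)

abbreviation cspan :: "'a::cstar_algebra set \<Rightarrow> 'a set"
  where "cspan \<equiv> cvec.span"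


(* The pair (a, c) stands for the element a + c 1 of the minimal unitization of 'a. *)
definition unitization_mult ::
    "'a::cstar_algebra \<times> complex \<Rightarrow> 'a \<times> complex \<Rightarrow> 'a \<times> complex"
  where "unitization_mult x y =
    (fst x * fst y + snd x *\<^sub>C fst y + snd y *\<^sub>C fst x, snd x * snd y)"

definition unitization_invertible :: "'a::cstar_algebra \<times> complex \<Rightarrow> bool"
  where "unitization_invertible x \<longleftrightarrow>
    (\<exists>y. unitization_mult x y = (0, 1) \<and> unitization_mult y x = (0, 1))"

(* The spectrum is always taken in the unitization, so it contains 0. If the algebra
   happens to have a unit, this is the usual spectrum with 0 adjoined, which affects neither
   positivity nor the functional calculus for functions vanishing at 0. *)
definition spectrum :: "'a::cstar_algebra \<Rightarrow> complex set"
  where "spectrum a = {z. \<not> unitization_invertible (a, - z)}"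

definition positive_elements :: "'a::cstar_algebra set"
  where "positive_elements = {a. star a = a \<and> spectrum a \<subseteq> \<real>\<^sub>\<ge>\<^sub>0}"

definition cstar_le :: "'a::cstar_algebra \<Rightarrow> 'a \<Rightarrow> bool"
  where "cstar_le a b \<longleftrightarrow> b - a \<in> positive_elements"


(* Exponents are shifted because there need not be a unit: pow_Suc a k is a^(k+1). *)
primrec pow_Suc :: "'a::semigroup_mult \<Rightarrow> nat \<Rightarrow> 'a"
  where
    "pow_Suc a 0 = a"
  | "pow_Suc a (Suc k) = a * pow_Suc a k"

(* Evaluation p(a), for polynomials p with p(0) = 0. *)
definition poly_apply :: "real poly \<Rightarrow> 'a::cstar_algebra \<Rightarrow> 'a"
  where "poly_apply p a = (\<Sum>k<degree p. coeff p (Suc k) *\<^sub>R pow_Suc a k)"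

(* Continuous functional calculus f(a), for self-adjoint a and f continuous on the spectrum
   of a with f(0) = 0: the continuous extension of polynomial evaluation from the
   polynomials vanishing at 0, which are uniformly dense in these functions f. *)
definition cfc :: "(real \<Rightarrow> real) \<Rightarrow> 'a::cstar_algebra \<Rightarrow> 'a"
  where "cfc f a = (THE b. \<forall>p :: nat \<Rightarrow> real poly.
      (\<forall>k. poly (p k) 0 = 0) \<longrightarrow>
      uniform_limit {t. complex_of_real t \<in> spectrum a} (\<lambda>k. poly (p k)) f sequentially \<longrightarrow>
      (\<lambda>k. poly_apply (p k) a) \<longlonglongrightarrow> b)"

(* The power a^s of a positive element, for s > 0. *)
definition positive_powr :: "'a::cstar_algebra \<Rightarrow> real \<Rightarrow> 'a"
  where "positive_powr a s = cfc (\<lambda>t. t powr s) a"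


definition is_ideal :: "'a::cstar_algebra set \<Rightarrow> bool"
  where "is_ideal I \<longleftrightarrow>
    0 \<in> I \<and> (\<forall>x\<in>I. \<forall>y\<in>I. x + y \<in> I) \<and> (\<forall>x\<in>I. - x \<in> I) \<and>
    (\<forall>a. \<forall>x\<in>I. a * x \<in> I \<and> x * a \<in> I)"

definition positive_part :: "'a::cstar_algebra set \<Rightarrow> 'a set"
  where "positive_part I = I \<inter> positive_elements"

definition order_ideal :: "'a::cstar_algebra set \<Rightarrow> bool"
  where "order_ideal M \<longleftrightarrow>
    M \<subseteq> positive_elements \<and> 0 \<in> M \<and> (\<forall>a\<in>M. \<forall>b\<in>M. a + b \<in> M) \<and>
    (\<forall>a\<in>positive_elements. \<forall>b\<in>positive_elements. cstar_le a b \<longrightarrow> b \<in> M \<longrightarrow> a \<in> M)"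

definition strongly_invariant :: "'a::cstar_algebra set \<Rightarrow> bool"
  where "strongly_invariant M \<longleftrightarrow> (\<forall>x. star x * x \<in> M \<longleftrightarrow> x * star x \<in> M)"

definition dixmier_ideal :: "'a::cstar_algebra set \<Rightarrow> bool"
  where "dixmier_ideal I \<longleftrightarrow>
    is_ideal I \<and> I = cspan (positive_part I) \<and>
    order_ideal (positive_part I) \<and> strongly_invariant (positive_part I)"

definition ideal_powr :: "'a::cstar_algebra set \<Rightarrow> real \<Rightarrow> 'a set"
  where "ideal_powr I s = cspan ((\<lambda>a. positive_powr a s) ` positive_part I)"

end

theory Submission
  imports Defs "HOL-Computational_Algebra.Fundamental_Theorem_Algebra"
begin

text \<open>
  Since \<open>(a\<^sup>n)\<^sup>1\<^sup>/\<^sup>n = a\<close>, the inclusion \<open>J \<subseteq> I\<^sup>1\<^sup>/\<^sup>n\<close> is immediate. Conversely, a positive \<open>b\<close> in \<open>J\<^sup>n\<close>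
  satisfies \<open>b \<le> c = \<Sum>i. a\<^sub>i\<^sup>n\<close> with positive \<open>a\<^sub>i\<close> in \<open>J\<close>, so by the Loewner-Heinz inequality it
  suffices to show that \<open>c\<^sup>1\<^sup>/\<^sup>n\<close> lies in \<open>J\<close>. Formally \<open>c\<^sup>1\<^sup>/\<^sup>n = \<Sum>i. y\<^sub>i\<^sup>* y\<^sub>i\<close> with
  \<open>y\<^sub>i = a\<^sub>i\<^sup>n\<^sup>/\<^sup>2 c\<^sup>-\<^sup>q\<close> and \<open>2 q = 1 - 1/n\<close>. As \<open>2 q \<le> 1\<close>, the map \<open>t \<mapsto> t\<^sup>-\<^sup>2\<^sup>q\<close> is operator antitone,
  whence \<open>y\<^sub>i y\<^sub>i\<^sup>* = a\<^sub>i\<^sup>n\<^sup>/\<^sup>2 c\<^sup>-\<^sup>2\<^sup>q a\<^sub>i\<^sup>n\<^sup>/\<^sup>2 \<le> a\<^sub>i\<close>, and strong invariance turns \<open>y\<^sub>i y\<^sub>i\<^sup>* \<in> J\<close> into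
  \<open>y\<^sub>i\<^sup>* y\<^sub>i \<in> J\<close>. Replacing \<open>t\<^sup>-\<^sup>q\<close> by \<open>max t \<epsilon>\<^sup>-\<^sup>q\<close> and letting \<open>\<epsilon>\<close> tend to \<open>0\<close> makes sense of \<open>c\<^sup>-\<^sup>q\<close>,
  at the cost of a factor \<open>2\<close> in the estimate.
\<close>

text \<open>\<open>J\<close> need not be norm closed, so membership in \<open>J\<close> cannot be
  obtained by approximation. Limits are therefore taken in the ambient algebra: the elements y_i
  converge in norm and the inequality between y_i y_i^* and a_i survives, because the positive cone
  is closed. Heredity and strong invariance of \<open>J\<close> enter only afterwards. Constants,
  shifts c + \<epsilon> 1 and inverses require a unit, so the analysis takes place in
  \<open>cstar_algebra_1\<close> and is applied to the unitization. The y_i nevertheless belong to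
  the original algebra, since t^(n/2) vanishes at 0. The exponent q is forced: the sum of the y_i^*
  y_i is formally c^(-q) c c^(-q), which has to be c^(1/n).\<close>

lemma star_zero [simp]: "star (0::'a::cstar_algebra) = 0"
  using star_scaleC[of 0 "0::'a"] by simp

lemma star_minus: "star (- x) = - star (x::'a::cstar_algebra)"
  using star_add[of x "- x"] by (simp add: eq_neg_iff_add_eq_0 add.commute)

lemma star_diff: "star (x - y) = star x - star (y::'a::cstar_algebra)"
  using star_add[of x "- y"] by (simp add: star_minus)

lemma star_scaleR: "star (r *\<^sub>R x) = r *\<^sub>R star (x::'a::cstar_algebra)"
  using star_scaleC[of "complex_of_real r" x] by (simp add: scaleC_of_real)

lemma star_sum: "star (sum f S) = (\<Sum>i\<in>S. star (f i :: 'a::cstar_algebra))"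
  by (induction S rule: infinite_finite_induct) (auto simp: star_add)

lemma norm_star [simp]: "norm (star x) = norm (x::'a::cstar_algebra)"
proof -
  have le: "norm y \<le> norm (star y)" for y :: 'a
  proof (cases "y = 0")
    case False
    have "(norm y)\<^sup>2 \<le> norm (star y) * norm y"
      using norm_mult_ineq[of "star y" y] by (simp add: cstar_identity)
    with False show ?thesis by (simp add: power2_eq_square)
  qed auto
  from le[of x] le[of "star x"] show ?thesis by (simp add: star_star)
qed

lemma cstar_identity': "norm (x * star x) = (norm (x::'a::cstar_algebra))\<^sup>2"
  using cstar_identity[of "star x"] by (simp add: star_star)

lemma bounded_linear_star: "bounded_linear (star :: 'a::cstar_algebra \<Rightarrow> 'a)"
  by (rule bounded_linear_intro[where K=1]) (auto simp: star_add star_scaleR)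

lemmas tendsto_star = bounded_linear.tendsto[OF bounded_linear_star]

lemma bounded_linear_scaleC: "bounded_linear ((*\<^sub>C) c :: 'a::cstar_algebra \<Rightarrow> 'a)"
  by (rule bounded_linear_intro[where K="cmod c"])
     (auto simp: scaleC_add_right norm_scaleC scaleC_scaleC mult.commute simp flip: scaleC_of_real)

section \<open>Spectrum and functional calculus in a unital C*-algebra\<close>

class cstar_algebra_1 = cstar_algebra + real_normed_algebra_1

lemma star_one [simp]: "star (1::'a::cstar_algebra_1) = 1"
  by (metis mult_1_left mult_1_right star_mult star_star)

definition inv_elem :: "'a::monoid_mult \<Rightarrow> bool"
  where "inv_elem x \<longleftrightarrow> (\<exists>y. x * y = 1 \<and> y * x = 1)"

definition inv_of :: "'a::monoid_mult \<Rightarrow> 'a"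
  where "inv_of x = (SOME y. x * y = 1 \<and> y * x = 1)"

lemma inv_elemI: "x * y = 1 \<Longrightarrow> y * x = 1 \<Longrightarrow> inv_elem x"
  unfolding inv_elem_def by blast

lemma inv_of:
  assumes "inv_elem x"
  shows "x * inv_of x = 1" "inv_of x * x = 1"
proof -
  have "x * inv_of x = 1 \<and> inv_of x * x = 1"
    using assms unfolding inv_elem_def inv_of_def by (rule someI_ex)
  then show "x * inv_of x = 1" "inv_of x * x = 1" by auto
qed

lemma inv_of_eqI:
  assumes "x * y = 1" "y * x = 1"
  shows "inv_of x = y"
proof -
  have "inv_elem x" using assms by (rule inv_elemI)
  have "inv_of x = inv_of x * (x * y)" using assms by simp
  also have "\<dots> = (inv_of x * x) * y" by (simp only: mult.assoc)
  also have "\<dots> = y" using inv_of[OF \<open>inv_elem x\<close>] by simp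
  finally show ?thesis .
qed

lemma inv_elem_1 [simp]: "inv_elem 1"
  by (rule inv_elemI[of _ 1]) auto

lemma inv_elem_mult:
  assumes "inv_elem x" "inv_elem y"
  shows "inv_elem (x * y)"
proof (rule inv_elemI)
  show "x * y * (inv_of y * inv_of x) = 1" "inv_of y * inv_of x * (x * y) = 1"
    using inv_of[OF assms(1)] inv_of[OF assms(2)]
    by (metis mult.assoc mult_1_left)+
qed

lemma inv_elem_scaleC:
  assumes "inv_elem (x::'a::cstar_algebra_1)" "c \<noteq> 0"
  shows "inv_elem (c *\<^sub>C x)"
  by (rule inv_elemI[of _ "inverse c *\<^sub>C inv_of x"])
     (use assms in \<open>auto simp: mult_scaleC_left mult_scaleC_right scaleC_scaleC inv_of\<close>)

lemma inv_elem_uminus: "inv_elem (- x) \<longleftrightarrow> inv_elem (x::'a::cstar_algebra_1)"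
  unfolding inv_elem_def by (metis minus_mult_minus minus_minus)

text \<open>The inverse is the geometric series. The quantitative part serves to show that the
  resolvent of a high power is close to \<open>1\<close>.\<close>

lemma inv_elem_Neumann:
  assumes "norm (x::'a::{real_normed_algebra_1,banach}) < 1"
  shows "inv_elem (1 - x)" "norm (inv_of (1 - x) - 1) \<le> norm x / (1 - norm x)"
proof -
  have s: "summable (\<lambda>n. x ^ n)" using assms by (rule complete_algebra_summable_geometric)
  define S where "S = (\<Sum>n. x ^ n)"
  have 1: "S = 1 + (\<Sum>n. x ^ Suc n)"
    unfolding S_def using suminf_split_head[OF s] by simp
  have s': "summable (\<lambda>n. x ^ Suc n)" using s by (subst summable_Suc_iff)
  have "x * S = (\<Sum>n. x ^ Suc n)" "S * x = (\<Sum>n. x ^ Suc n)"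
    unfolding S_def
    using suminf_mult[OF s, of x] suminf_mult2[OF s, of x] by (simp_all add: power_commutes)
  then have inv: "(1 - x) * S = 1" "S * (1 - x) = 1"
    using 1 by (simp_all add: algebra_simps)
  then show "inv_elem (1 - x)" by (rule inv_elemI)
  have "inv_of (1 - x) = S" using inv by (rule inv_of_eqI)
  then have e: "inv_of (1 - x) - 1 = x * S" using inv by (simp add: algebra_simps)
  have "norm S \<le> 1 + norm x * norm S"
    using norm_triangle_ineq[of 1 "x * S"] norm_mult_ineq[of x S] inv by (simp add: algebra_simps)
  then have "norm S \<le> 1 / (1 - norm x)" using assms by (simp add: field_simps)
  then have "norm x * norm S \<le> norm x * (1 / (1 - norm x))" by (intro mult_left_mono) auto
  then show "norm (inv_of (1 - x) - 1) \<le> norm x / (1 - norm x)"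
    unfolding e using norm_mult_ineq[of x S] by simp
qed

instance cstar_algebra \<subseteq> banach ..

section \<open>The spectrum: norm bound, algebraic rules, reality for self-adjoint elements\<close>

definition usp :: "'a::cstar_algebra_1 \<Rightarrow> complex set"
  where "usp a = {z. \<not> inv_elem (a - z *\<^sub>C 1)}"

lemma usp_norm:
  assumes "z \<in> usp (a::'a::cstar_algebra_1)"
  shows "cmod z \<le> norm a"
proof (rule ccontr)
  assume "\<not> ?thesis"
  then have z: "cmod z > norm a" "z \<noteq> 0" using norm_ge_zero[of a] by (auto simp del: norm_ge_zero)
  have "norm (inverse z *\<^sub>C a) < 1"
    using z by (simp add: norm_scaleC norm_inverse divide_simps norm_divide)
  then have "inv_elem (1 - inverse z *\<^sub>C a)" by (rule inv_elem_Neumann)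
  then have "inv_elem ((- z) *\<^sub>C (1 - inverse z *\<^sub>C a))" using z by (intro inv_elem_scaleC) auto
  also have "(- z) *\<^sub>C (1 - inverse z *\<^sub>C a) = a - z *\<^sub>C 1"
    using z by (simp add: cvec.scale_right_diff_distrib scaleC_scaleC)
  finally show False using assms by (simp add: usp_def)
qed

lemma usp_shift: "z \<in> usp (a + c *\<^sub>C 1) \<longleftrightarrow> z - c \<in> usp (a::'a::cstar_algebra_1)"
  by (simp add: usp_def cvec.scale_left_diff_distrib algebra_simps)

lemma usp_uminus: "z \<in> usp (- a) \<longleftrightarrow> - z \<in> usp (a::'a::cstar_algebra_1)"
proof -
  have "- (a - (- z) *\<^sub>C 1) = - a - z *\<^sub>C 1" by simp
  then show ?thesis unfolding usp_def using inv_elem_uminus by (metis mem_Collect_eq)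
qed

lemma usp_scaleC:
  assumes "c \<noteq> 0"
  shows "z \<in> usp (c *\<^sub>C a) \<longleftrightarrow> z / c \<in> usp (a::'a::cstar_algebra_1)"
proof -
  have e: "c *\<^sub>C (a - (z / c) *\<^sub>C 1) = c *\<^sub>C a - z *\<^sub>C 1" 
          "inverse c *\<^sub>C (c *\<^sub>C a - z *\<^sub>C 1) = a - (z / c) *\<^sub>C 1"
    using assms by (simp_all add: cvec.scale_right_diff_distrib scaleC_scaleC field_simps)
  show ?thesis unfolding usp_def using inv_elem_scaleC e assms
    by (metis inverse_nonzero_iff_nonzero mem_Collect_eq)
qed

lemma usp_of_real_diff:
  "z \<in> usp (r *\<^sub>R 1 - a) \<longleftrightarrow> complex_of_real r - z \<in> usp (a::'a::cstar_algebra_1)"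
  using usp_shift[of z "- a" "complex_of_real r"] usp_uminus[of "z - complex_of_real r" a]
  by (simp add: scaleC_of_real algebra_simps)

text \<open>If \<open>u\<close> inverts \<open>1 - x * y\<close>, then \<open>1 + y * u * x\<close>
  inverts \<open>1 - y * x\<close>, as the geometric series suggests. After scaling, this yields the
  agreement of the nonzero spectra of \<open>x * y\<close> and \<open>y * x\<close>.\<close>

lemma inv_elem_one_minus_commute:
  assumes "inv_elem (1 - x * y :: 'a::ring_1)"
  shows "inv_elem (1 - y * x)"
proof -
  define u where "u = inv_of (1 - x * y)"
  have u: "u - x * y * u - 1 = 0" "u - u * x * y - 1 = 0"
    using inv_of[OF assms] by (simp_all add: u_def algebra_simps)
  have "(1 - y * x) * (1 + y * u * x) = 1 + y * (u - x * y * u - 1) * x"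
       "(1 + y * u * x) * (1 - y * x) = 1 + y * (u - u * x * y - 1) * x"
    by (simp_all add: algebra_simps)
  then show ?thesis unfolding u by (intro inv_elemI[of _ "1 + y * u * x"]) auto
qed

lemma usp_mult_commute:
  assumes "z \<in> usp (x * y)" "z \<noteq> 0"
  shows "z \<in> usp (y * x :: 'a::cstar_algebra_1)"
proof (rule ccontr)
  assume "z \<notin> usp (y * x)"
  then have i: "inv_elem (y * x - z *\<^sub>C 1)" by (simp add: usp_def)
  have e: "(- inverse z) *\<^sub>C (u * v - z *\<^sub>C 1) = 1 - (inverse z *\<^sub>C u) * v" 
          "(- z) *\<^sub>C (1 - u * (inverse z *\<^sub>C v)) = u * v - z *\<^sub>C 1" for u v :: 'a
    using assms by (simp_all add: cvec.scale_right_diff_distrib scaleC_scaleC 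
        mult_scaleC_left mult_scaleC_right)
  have "inv_elem ((- inverse z) *\<^sub>C (y * x - z *\<^sub>C 1))" 
    using i assms by (intro inv_elem_scaleC) auto
  then have "inv_elem (1 - x * (inverse z *\<^sub>C y))"
    unfolding e by (rule inv_elem_one_minus_commute)
  then have "inv_elem ((- z) *\<^sub>C (1 - x * (inverse z *\<^sub>C y)))" 
    using assms by (intro inv_elem_scaleC) auto
  then show False using assms unfolding e by (simp add: usp_def)
qed

text \<open>Allows a norm bound on a product that is not self-adjoint to control the spectrum of a
  self-adjoint element similar to it, as in \<open>Loewner_Heinz_midpoint\<close>.\<close>

lemma usp_similar:
  assumes "s * t = 1" "t * s = (1::'a::cstar_algebra_1)"
  shows "usp (s * x * t) \<subseteq> usp x"
proof
  fix z assume z: "z \<in> usp (s * x * t)"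
  have e: "s * (x - z *\<^sub>C 1) * t = s * x * t - z *\<^sub>C 1"
    using assms by (simp add: algebra_simps mult_scaleC_left mult_scaleC_right)
  have "inv_elem s" "inv_elem t" using assms by (auto intro: inv_elemI)
  then show "z \<in> usp x" using z unfolding usp_def mem_Collect_eq e[symmetric]
    by (meson inv_elem_mult)
qed

text \<open>Shift \<open>a\<close> by an imaginary multiple \<open>l\<close> of the unit. By the
  C*-identity \<open>l\<^sup>2\<close> occurs on both sides of the norm bound and cancels; what is
  left is linear in \<open>l\<close>, hence impossible for all \<open>l\<close> unless the imaginary
  part vanishes.\<close>

lemma usp_selfadjoint_real:
  assumes "star a = (a::'a::cstar_algebra_1)" "z \<in> usp a"
  shows "z \<in> \<real>"
proof -
  define \<beta> where "\<beta> = Im z"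
  have key: "\<beta>\<^sup>2 + 2 * \<beta> * l \<le> (norm a)\<^sup>2" for l :: real
  proof -
    let ?w = "a + (\<i> * complex_of_real l) *\<^sub>C 1"
    have "z + \<i> * complex_of_real l \<in> usp ?w" using assms by (simp add: usp_shift)
    then have "cmod (z + \<i> * complex_of_real l) \<le> norm ?w" by (rule usp_norm)
    then have 1: "(cmod (z + \<i> * complex_of_real l))\<^sup>2 \<le> norm (star ?w * ?w)"
      by (simp add: cstar_identity power_mono)
    have "star ?w * ?w = a * a + complex_of_real (l\<^sup>2) *\<^sub>C 1"
      using assms(1)
      by (simp add: star_add star_scaleC algebra_simps mult_scaleC_left mult_scaleC_right scaleC_scaleC
          power2_eq_square)
    then have "norm (star ?w * ?w) \<le> norm (a * a) + l\<^sup>2"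
      using norm_triangle_ineq[of "a * a" "complex_of_real (l\<^sup>2) *\<^sub>C 1"] by (simp add: norm_scaleC norm_power)
    then have 2: "norm (star ?w * ?w) \<le> (norm a)\<^sup>2 + l\<^sup>2"
      using norm_mult_ineq[of a a] by (simp add: power2_eq_square)
    have "(\<beta> + l)\<^sup>2 \<le> (cmod (z + \<i> * complex_of_real l))\<^sup>2"
      by (simp add: cmod_power2 \<beta>_def)
    with 1 2 show ?thesis by (simp add: power2_eq_square algebra_simps)
  qed
  have "\<beta> = 0"
  proof (rule ccontr)
    assume "\<beta> \<noteq> 0"
    \<comment> \<open>This value of \<open>l\<close> turns \<open>key\<close> into
      \<open>\<beta>\<^sup>2 + (norm a)\<^sup>2 + 1 \<le> (norm a)\<^sup>2\<close>.\<close>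
    then have "2 * \<beta> * (((norm a)\<^sup>2 + 1) / (2 * \<beta>)) = (norm a)\<^sup>2 + 1" by simp
    then show False using key[of "((norm a)\<^sup>2 + 1) / (2 * \<beta>)"] zero_le_power2[of \<beta>] 
      by linarith
  qed
  then show ?thesis by (simp add: \<beta>_def complex_is_Real_iff)
qed

section \<open>The spectral radius of a self-adjoint element\<close>

lemma star_power: "star (a ^ n) = (star (a::'a::cstar_algebra_1)) ^ n"
  by (induction n) (auto simp: star_mult power_commutes)

lemma norm_power_selfadjoint:
  assumes "star a = (a::'a::cstar_algebra_1)"
  shows "norm (a ^ 2 ^ k) = norm a ^ 2 ^ k"
proof (induction k)
  case (Suc k)
  have "norm (a ^ 2 ^ Suc k) = norm (star (a ^ 2 ^ k) * a ^ 2 ^ k)"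
    using assms by (simp add: star_power mult_2 power_add)
  also have "\<dots> = (norm a ^ 2 ^ k)\<^sup>2" using Suc by (simp only: cstar_identity)
  also have "\<dots> = norm a ^ 2 ^ Suc k" by (simp flip: power_mult add: mult.commute)
  finally show ?case .
qed auto

text \<open>Rests on the resolvent identity, which compares \<open>G z\<close> and
  \<open>G w\<close> without any power series. On the compact unit disc continuity becomes uniform,
  which is what the next lemma exploits.\<close>

lemma continuous_on_resolvent:
  fixes x :: "'a::cstar_algebra_1"
  assumes inv: "\<And>z. z \<in> S \<Longrightarrow> inv_elem (1 - z *\<^sub>C x)" and x: "norm x \<le> 1"
  shows "continuous_on S (\<lambda>z. inv_of (1 - z *\<^sub>C x))"
proof -
  define G where "G z = inv_of (1 - z *\<^sub>C x)" for z
  have diff: "norm (G z - G w) \<le> cmod (z - w) * norm (G z) * norm (G w)" if "z \<in> S" "w \<in> S" for z w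
  proof -
    have i: "G z * (1 - z *\<^sub>C x) = 1" "(1 - w *\<^sub>C x) * G w = 1"
      using inv_of[OF inv[OF that(1)]] inv_of[OF inv[OF that(2)]] by (auto simp: G_def)
    have "G z - G w = G z * ((1 - w *\<^sub>C x) * G w) - (G z * (1 - z *\<^sub>C x)) * G w"
      using i by simp
    also have "\<dots> = G z * ((z - w) *\<^sub>C x) * G w"
      by (simp add: algebra_simps)
    finally have "norm (G z - G w) \<le> norm (G z) * norm ((z - w) *\<^sub>C x) * norm (G w)"
      using norm_mult_ineq[of "G z * ((z - w) *\<^sub>C x)" "G w"]
        mult_right_mono[OF norm_mult_ineq[of "G z" "(z - w) *\<^sub>C x"] norm_ge_zero[of "G w"]]
      by (simp only:)
    also have "\<dots> \<le> norm (G z) * (cmod (z - w) * 1) * norm (G w)"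
      unfolding norm_scaleC using x by (intro mult_right_mono mult_left_mono) auto
    finally show ?thesis by (simp add: mult_ac)
  qed
  have "continuous_on S G"
    unfolding continuous_on_iff
  proof (intro ballI allI impI)
    fix w and e :: real assume w: "w \<in> S" and e: "e > 0"
    define N where "N = norm (G w) + 1"
    have N: "N \<ge> 1" "norm (G w) \<le> N" by (auto simp: N_def)
    \<comment> \<open>Within \<open>1 / (2 * N)\<close> half of \<open>norm (G z)\<close> can be
      absorbed, which gives \<open>norm (G z) \<le> 2 * N\<close>; within
      \<open>e / (2 * N * N)\<close> the estimate \<open>diff\<close> then drops below
      \<open>e\<close>.\<close>
    show "\<exists>d>0. \<forall>z\<in>S. dist z w < d \<longrightarrow> dist (G z) (G w) < e"
    proof (intro exI[of _ "min (1 / (2 * N)) (e / (2 * N * N))"] conjI ballI impI)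
      show "0 < min (1 / (2 * N)) (e / (2 * N * N))" using N e by auto
    next
      fix z assume z: "z \<in> S" and d: "dist z w < min (1 / (2 * N)) (e / (2 * N * N))"
      have d1: "cmod (z - w) * N \<le> 1 / 2" and d2: "cmod (z - w) * (2 * N * N) < e"
        using d N by (auto simp: dist_norm field_simps)
      have "cmod (z - w) * norm (G z) * norm (G w) \<le> norm (G z) * (cmod (z - w) * N)"
        using mult_left_mono[OF N(2), of "norm (G z) * cmod (z - w)"] by (simp add: mult_ac)
      also have "\<dots> \<le> norm (G z) * (1/2)" using d1 by (intro mult_left_mono) auto
      finally have "norm (G z) - norm (G w) \<le> norm (G z) * (1/2)"
        using diff[OF z w] norm_triangle_ineq2[of "G z" "G w"] by linarith
      then have "norm (G z) \<le> 2 * N" using N by simp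
      then have "norm (G z) * norm (G w) \<le> 2 * N * N" using N by (intro mult_mono) auto
      then have "cmod (z - w) * (norm (G z) * norm (G w)) \<le> cmod (z - w) * (2 * N * N)"
        by (intro mult_left_mono) auto
      then show "dist (G z) (G w) < e"
        using diff[OF z w] d2 unfolding dist_norm by (simp only: mult.assoc)
    qed
  qed
  then show ?thesis by (simp add: G_def[abs_def])
qed

text \<open>If \<open>norm x = 1\<close> but \<open>1 - z x\<close> were invertible on the closed unit disc, then averaging
  over the \<open>2\<^sup>k\<close>-th roots of unity shows that the resolvent of \<open>x ^ 2 ^ k\<close> on the unit circle is,
  uniformly in \<open>k\<close>, close to its value on a slightly smaller circle, where it tends to \<open>1\<close>.
  This contradicts \<open>norm (x ^ 2 ^ k) = 1\<close> and avoids complex analysis.\<close>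

lemma norm_le_spectral_radius:
  fixes a :: "'a::cstar_algebra_1"
  assumes sa: "star a = a" and r: "\<And>z. z \<in> usp a \<Longrightarrow> cmod z \<le> r" and "r \<ge> 0"
  shows "norm a \<le> r"
proof (rule ccontr)
  assume neg: "\<not> norm a \<le> r"
  define m where "m = norm a"
  have m: "m > r" "m > 0" using neg \<open>r \<ge> 0\<close> by (auto simp: m_def)
  define x where "x = complex_of_real (1 / m) *\<^sub>C a"
  have nx: "norm x = 1" using m by (simp add: x_def norm_scaleC m_def norm_divide)
  have sax: "star x = x" using sa by (simp add: x_def star_scaleC)
  have inv0: "inv_elem (1 - z *\<^sub>C x)" if z: "cmod z \<le> 1" for z
  proof (cases "z = 0")
    case False
    have "1 / z \<notin> usp x"
    proof
      assume "1 / z \<in> usp x"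
      then have "1 / z / complex_of_real (1 / m) \<in> usp a"
        unfolding x_def using m by (subst (asm) usp_scaleC) auto
      then have "cmod (complex_of_real m / z) \<le> r" by (intro r) (simp add: field_simps)
      then have "m / cmod z \<le> r" using m by (simp add: norm_divide)
      moreover have "m \<le> m / cmod z" using z m False by (simp add: field_simps)
      ultimately show False using m by simp
    qed
    then have "inv_elem ((- z) *\<^sub>C (x - (1 / z) *\<^sub>C 1))"
      using False by (intro inv_elem_scaleC) (auto simp: usp_def)
    then show ?thesis using False by (simp add: cvec.scale_right_diff_distrib scaleC_scaleC)
  qed auto
  define Y where "Y k z = (z *\<^sub>C x) ^ 2 ^ k" for k and z :: complex
  define G where "G k z = inv_of (1 - Y k z)" for k and z :: complex
  \<comment> \<open>A \<open>2 ^ k\<close>-th root of \<open>- 1\<close>: rotating \<open>z\<close>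
    by it flips the sign of \<open>Y k z\<close> and so supplies the second factor of
    \<open>1 - Y k z * Y k z\<close>.\<close>
  define \<zeta> where "\<zeta> k = cis (pi / 2 ^ k)" for k :: nat
  have cz [simp]: "cmod (\<zeta> k) = 1" for k by (simp add: \<zeta>_def)
  have zk: "\<zeta> k ^ 2 ^ k = -1" for k by (simp add: \<zeta>_def Complex.DeMoivre)
  have scale_power: "(c *\<^sub>C y) ^ n = (c ^ n) *\<^sub>C (y ^ n)" for c and y :: 'a and n
    by (induction n) (auto simp: mult_scaleC_left mult_scaleC_right scaleC_scaleC mult.commute)
  have Y\<zeta>: "Y k (\<zeta> k * z) = - Y k z" for k z
    unfolding Y_def by (simp add: scale_power power_mult_distrib zk)
  have YSuc: "Y (Suc k) z = Y k z * Y k z" for k z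
    unfolding Y_def by (simp add: mult_2 power_add)
  have inv: "inv_elem (1 - Y k z)" if "cmod z \<le> 1" for k z
    using that
  proof (induction k arbitrary: z)
    case 0 then show ?case using inv0 by (simp add: Y_def)
  next
    case (Suc k)
    have "1 - Y (Suc k) z = (1 - Y k z) * (1 - Y k (\<zeta> k * z))"
      unfolding YSuc Y\<zeta> by (simp add: algebra_simps)
    moreover have "inv_elem (1 - Y k z)" "inv_elem (1 - Y k (\<zeta> k * z))"
      using Suc by (simp_all add: norm_mult)
    ultimately show ?case using inv_elem_mult by metis
  qed
  \<comment> \<open>Partial fractions: the inverse of 1 - y^2 is the mean of the inverses of 1 - y
    and 1 + y. Iteration produces the average over roots of unity.\<close>
  have GSuc: "G (Suc k) z = (1/2) *\<^sub>R (G k z + G k (\<zeta> k * z))" if z: "cmod z \<le> 1" for k z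
  proof -
    define y where "y = Y k z"
    define u where "u = G k z"
    define v where "v = G k (\<zeta> k * z)"
    have u: "(1 - y) * u = 1" "u * (1 - y) = 1"
      using inv_of[OF inv[OF z]] by (auto simp: u_def y_def G_def)
    have v: "(1 + y) * v = 1" "v * (1 + y) = 1"
      using inv_of[OF inv[of "\<zeta> k * z" k]] z by (auto simp: v_def y_def G_def Y\<zeta> norm_mult)
    have "(1 - y * y) * (u + v) = (1 + y) * ((1 - y) * u) + (1 - y) * ((1 + y) * v)"
         "(u + v) * (1 - y * y) = (u * (1 - y)) * (1 + y) + (v * (1 + y)) * (1 - y)"
      by (simp_all add: algebra_simps)
    then have "(1 - y * y) * (u + v) = 2 *\<^sub>R 1" "(u + v) * (1 - y * y) = 2 *\<^sub>R 1"
      unfolding u v by (simp_all add: scaleR_2)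
    then show ?thesis unfolding G_def[of "Suc k"] YSuc
      by (intro inv_of_eqI) (auto simp: u_def v_def y_def)
  qed
  have "continuous_on (cball 0 1) (G 0)"
    using continuous_on_resolvent[of "cball 0 1" x] inv0 nx by (simp add: G_def[abs_def] Y_def)
  then have "uniformly_continuous_on (cball 0 1) (G 0)"
    by (rule compact_uniformly_continuous) auto
  then obtain d where d: "d > 0" 
    "\<And>z w. \<lbrakk>z \<in> cball 0 1; w \<in> cball 0 1; dist w z < d\<rbrakk> \<Longrightarrow> dist (G 0 w) (G 0 z) < 1/8"
    unfolding uniformly_continuous_on_def by (metis zero_less_divide_1_iff zero_less_numeral)
  define s where "s = max (1/2) (1 - d/2)"
  have s: "0 < s" "s < 1" "1 - s < d" using d(1) by (auto simp: s_def)
  \<comment> \<open>An average of two errors is no larger than their bound, so the estimate obtained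
    from uniform continuity of \<open>G 0\<close> persists for every \<open>k\<close>.\<close>
  have close: "norm (G k z - G k (s * z)) \<le> 1/8" if "cmod z = 1" for k and z :: complex
    using that
  proof (induction k arbitrary: z)
    case 0
    have "z - s * z = complex_of_real (1 - s) * z" by (simp add: left_diff_distrib)
    then have "dist z (s * z) = cmod (complex_of_real (1 - s)) * cmod z"
      by (simp only: dist_norm norm_mult)
    also have "\<dots> = 1 - s" using s 0 by (simp only: norm_of_real) simp
    finally have "dist z (s * z) < d" using s by simp
    then have "dist (G 0 z) (G 0 (s * z)) < 1/8" 
      by (intro d) (use 0 s in \<open>auto simp: norm_mult\<close>)
    then show ?case by (simp add: dist_norm)
  next
    case (Suc k)
    have "G (Suc k) z - G (Suc k) (s * z) =
        (1/2) *\<^sub>R ((G k z - G k (s * z)) + (G k (\<zeta> k * z) - G k (s * (\<zeta> k * z))))"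
      using Suc s by (simp add: GSuc norm_mult algebra_simps)
    moreover have "norm (G k z - G k (s * z)) \<le> 1/8" 
      "norm (G k (\<zeta> k * z) - G k (s * (\<zeta> k * z))) \<le> 1/8"
      using Suc by (auto simp: norm_mult)
    ultimately show ?case
      using norm_triangle_ineq[of "G k z - G k (s * z)" "G k (\<zeta> k * z) - G k (s * (\<zeta> k * z))"]
      by simp
  qed
  \<comment> \<open>\<open>1/9\<close> makes the Neumann bound \<open>(1/9) / (1 - 1/9)\<close>
    equal to \<open>1/8\<close>. Together with \<open>close\<close> this gives
    \<open>norm e \<le> 1/4\<close>, too small for \<open>u = e * (1 - u)\<close> with
    \<open>norm u = 1\<close>.\<close>
  obtain N where N: "s ^ N < 1/9" using s real_arch_pow_inv[of "1/9" s] by auto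
  define e where "e = G N 1 - 1"
  have "s ^ 2 ^ N \<le> s ^ N" using s by (intro power_decreasing) auto
  moreover have "norm (Y N s) = s ^ 2 ^ N" using s nx
    by (simp add: Y_def scale_power norm_scaleC norm_power norm_power_selfadjoint sax)
  ultimately have "norm (Y N s) < 1/9" using N by linarith
  then have "norm (G N s - 1) \<le> norm (Y N s) / (1 - norm (Y N s))"
    unfolding G_def by (intro inv_elem_Neumann) auto
  moreover have "norm (Y N s) / (1 - norm (Y N s)) \<le> (1/9) / (8/9)"
    using \<open>norm (Y N s) < 1/9\<close> by (intro frac_le) auto
  ultimately have "norm (G N s - 1) \<le> 1/8" by (rule order_trans[OF _ order_trans]) simp
  moreover have "norm (G N 1 - G N s) \<le> 1/8" using close[of 1 N] by simp
  ultimately have e: "norm e \<le> 1/4" unfolding e_def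
    using norm_triangle_ineq[of "G N 1 - G N s" "G N s - 1"] by simp
  define u where "u = Y N 1"
  have "norm u = 1" using nx by (simp add: u_def Y_def norm_power_selfadjoint sax)
  have "G N 1 * (1 - u) = 1" using inv_of[OF inv[of 1 N]] by (simp add: G_def u_def)
  then have "u = e * (1 - u)" by (simp add: e_def algebra_simps)
  then have "norm u \<le> norm e * norm (1 - u)" by (metis norm_mult_ineq)
  also have "\<dots> \<le> 1/4 * 2" using e norm_triangle_ineq4[of 1 u] \<open>norm u = 1\<close> by (intro mult_mono) auto
  finally show False using \<open>norm u = 1\<close> by simp
qed

section \<open>Polynomial functional calculus and spectral mapping\<close>

definition uev :: "complex poly \<Rightarrow> 'a::cstar_algebra_1 \<Rightarrow> 'a"
  where "uev p a = (\<Sum>i\<le>degree p. coeff p i *\<^sub>C a ^ i)"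

lemma uev_0 [simp]: "uev 0 a = 0"
  by (simp add: uev_def)

lemma uev_pCons: "uev (pCons c p) a = c *\<^sub>C 1 + a * uev p a"
proof (cases "p = 0")
  case False
  then show ?thesis
    by (simp add: uev_def sum.atMost_Suc_shift sum_distrib_left mult_scaleC_right del: sum.atMost_Suc)
qed (simp add: uev_def)

lemma uev_add: "uev (p + q) a = uev p a + uev q a"
  by (induction p q rule: poly_induct2) (auto simp: uev_pCons algebra_simps scaleC_add_left)

lemma uev_smult: "uev (smult c p) a = c *\<^sub>C uev p a"
  by (induction p) (auto simp: uev_pCons scaleC_add_right scaleC_scaleC mult_scaleC_right)

lemma uev_mult: "uev (p * q) a = uev p a * uev q a"
  by (induction p) (auto simp: uev_pCons uev_add uev_smult algebra_simps mult_scaleC_left)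

text \<open>Split off one linear factor at a time, using the fundamental theorem of algebra: no root
  lies in the spectrum, so each factor \<open>a - z *\<^sub>C 1\<close> is invertible.\<close>

lemma inv_elem_uev:
  assumes "p \<noteq> 0" "\<And>z. z \<in> usp a \<Longrightarrow> poly p z \<noteq> 0"
  shows "inv_elem (uev p a)"
  using assms
proof (induction "degree p" arbitrary: p)
  case 0
  then obtain c where "p = [:c:]" by (metis degree_eq_zeroE)
  with 0 have "uev p a = c *\<^sub>C 1" "c \<noteq> 0" by (auto simp: uev_pCons)
  then show ?case by (metis inv_elem_1 inv_elem_scaleC)
next
  case (Suc n)
  have "\<not> constant (poly p)" using Suc.hyps by (simp add: constant_degree)
  then obtain z where z: "poly p z = 0" using fundamental_theorem_of_algebra by blast
  then obtain q where q: "p = [:-z, 1:] * q" by (metis dvdE poly_eq_0_iff_dvd)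
  have "q \<noteq> 0" using q Suc.prems by auto
  have "degree p = 1 + degree q" unfolding q using \<open>q \<noteq> 0\<close> by (subst degree_mult_eq) auto
  then have "inv_elem (uev q a)"
    using Suc.hyps(2) \<open>q \<noteq> 0\<close> Suc.prems(2) by (intro Suc.hyps(1)) (auto simp: q)
  moreover have "inv_elem (a - z *\<^sub>C 1)" using z Suc.prems(2) unfolding usp_def by blast
  moreover have "uev [:-z, 1:] a = a - z *\<^sub>C 1" by (simp add: uev_pCons)
  ultimately show ?case unfolding q uev_mult by (simp add: inv_elem_mult)
qed

text \<open>For an empty spectrum the spectral radius bound holds vacuously with radius
  \<open>0\<close> and forces \<open>a = 0\<close>; but \<open>0\<close> is not invertible.\<close>

lemma usp_selfadjoint_nonempty:
  assumes "star a = (a::'a::cstar_algebra_1)"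
  shows "usp a \<noteq> {}"
proof
  assume e: "usp a = {}"
  then have "norm a \<le> 0" using assms by (intro norm_le_spectral_radius) auto
  then have "0 \<in> usp a" by (auto simp: usp_def inv_elem_def)
  with e show False by simp
qed

lemma usp_uev:
  assumes "star a = (a::'a::cstar_algebra_1)" "z \<in> usp (uev p a)"
  shows "\<exists>w\<in>usp a. poly p w = z"
proof (cases "p = [:z:]")
  \<comment> \<open>A constant polynomial takes its value at any point of the spectrum, so a point
    has to exist.\<close>
  case True then show ?thesis using usp_selfadjoint_nonempty[OF assms(1)] by auto
next
  case False
  have "uev (p + [:- z:]) a = uev p a - z *\<^sub>C 1" by (simp only: uev_add) (simp add: uev_pCons)
  then have "\<not> inv_elem (uev (p + [:- z:]) a)" using assms(2) by (simp add: usp_def)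
  moreover have "p + [:- z:] \<noteq> 0" using False by (metis add_eq_0_iff minus_pCons minus_zero neg_equal_iff_equal)
  ultimately obtain w where "w \<in> usp a" "poly (p + [:- z:]) w = 0" using inv_elem_uev by blast
  then show ?thesis by auto
qed

abbreviation rpoly :: "real poly \<Rightarrow> complex poly" where "rpoly \<equiv> map_poly complex_of_real"

lemma rpoly_hom:
  "rpoly (p + q) = rpoly p + rpoly q" "rpoly (p * q) = rpoly p * rpoly q"
  "rpoly (smult c p) = smult (of_real c) (rpoly p)" "rpoly (pCons c p) = pCons (of_real c) (rpoly p)"
  by (auto intro!: poly_eqI simp: coeff_map_poly coeff_mult coeff_pCons split: nat.splits)

lemma poly_rpoly: "poly (rpoly p) (of_real t) = of_real (poly p t)"
  by (induction p) (auto simp: rpoly_hom)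

definition reval :: "real poly \<Rightarrow> 'a::cstar_algebra_1 \<Rightarrow> 'a"
  where "reval p a = uev (rpoly p) a"

lemma reval_simps:
  "reval 0 a = 0" "reval (pCons c p) a = c *\<^sub>R 1 + a * reval p a"
  "reval (p + q) a = reval p a + reval q a" "reval (smult c p) a = c *\<^sub>R reval p a"
  "reval (p * q) a = reval p a * reval q a"
  unfolding reval_def
  by (simp_all add: rpoly_hom uev_add uev_mult uev_smult uev_pCons scaleC_of_real)

lemma reval_diff: "reval (p - q) a = reval p a - reval q a"
  using reval_simps(3)[of p "smult (- 1) q" a] reval_simps(4)[of "- 1" q a] by simp

lemma star_reval:
  assumes "star a = a"
  shows "star (reval p a) = reval p a"
proof (induction p)
  case (pCons c p)
  have "reval p a * a = reval ([:0,1:] * p) a"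
    by (subst mult.commute, simp only: reval_simps(5)) (simp add: reval_simps)
  then have "reval p a * a = a * reval p a" by (simp add: reval_simps)
  with pCons assms show ?case by (simp add: reval_simps star_add star_mult star_scaleR)
qed (simp add: reval_simps)

definition rsp :: "'a::cstar_algebra_1 \<Rightarrow> real set"
  where "rsp a = {t. complex_of_real t \<in> usp a}"

lemma rsp_bound: "t \<in> rsp a \<Longrightarrow> \<bar>t\<bar> \<le> norm a"
  using usp_norm[of "of_real t" a] by (simp add: rsp_def)

lemma usp_eq_rsp:
  assumes "star a = a"
  shows "usp a = complex_of_real ` rsp a"
  using usp_selfadjoint_real[OF assms] by (auto simp: rsp_def Reals_def)

text \<open>Spectral mapping combined with the spectral radius bound. Evaluation is thus contractive
  for the supremum over the spectrum, which is why it extends from polynomials to continuous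
  functions.\<close>

lemma norm_reval_le:
  assumes sa: "star a = a" and B: "\<And>t. t \<in> rsp a \<Longrightarrow> \<bar>poly p t\<bar> \<le> B"
  shows "norm (reval p a) \<le> B"
proof (rule norm_le_spectral_radius)
  show "star (reval p a) = reval p a" using sa by (rule star_reval)
  fix z assume "z \<in> usp (reval p a)"
  then obtain w where "w \<in> usp a" "poly (rpoly p) w = z"
    using usp_uev[OF sa] unfolding reval_def by blast
  then show "cmod z \<le> B" using B by (auto simp: usp_eq_rsp[OF sa] poly_rpoly)
next
  obtain t where "t \<in> rsp a" using usp_selfadjoint_nonempty[OF sa] by (auto simp: usp_eq_rsp[OF sa])
  then show "B \<ge> 0" using B[of t] by auto
qed

section \<open>Continuous functional calculus\<close>

lemma Weierstrass_poly:
  fixes f :: "real \<Rightarrow> real"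
  assumes "continuous_on {l..u} f" "e > 0"
  obtains p where "\<And>t. t \<in> {l..u} \<Longrightarrow> \<bar>poly p t - f t\<bar> < e"
proof -
  obtain g where g: "real_polynomial_function g" "\<And>x. x \<in> {l..u} \<Longrightarrow> \<bar>f x - g x\<bar> < e"
    using Stone_Weierstrass_real_polynomial_function[of "{l..u}" f e] assms by auto
  then obtain c n where "g = (\<lambda>x. \<Sum>i\<le>n. c i * x ^ i)"
    unfolding real_polynomial_function_iff_sum by blast
  then have "g x = poly (\<Sum>i\<le>n. monom (c i) i) x" for x by (simp add: poly_sum poly_monom)
  with g(2) show ?thesis by (intro that[of "\<Sum>i\<le>n. monom (c i) i"]) (simp add: abs_minus_commute)
qed

lemma Weierstrass_seq:
  fixes f :: "real \<Rightarrow> real"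
  assumes "continuous_on UNIV f"
  obtains p where "uniform_limit {-M..M} (\<lambda>k. poly (p k)) f sequentially"
proof -
  have "\<exists>p. \<forall>t\<in>{-M..M}. \<bar>poly p t - f t\<bar> < 1 / real (Suc k)" for k
    using Weierstrass_poly[of "-M" M f "1 / real (Suc k)"] continuous_on_subset[OF assms]
    by (metis of_nat_0_less_iff subset_UNIV zero_less_Suc zero_less_divide_1_iff)
  then obtain p where p: "\<And>k t. t \<in> {-M..M} \<Longrightarrow> \<bar>poly (p k) t - f t\<bar> < 1 / real (Suc k)"
    by metis
  have "uniform_limit {-M..M} (\<lambda>k. poly (p k)) f sequentially"
  proof (rule uniform_limitI)
    fix e :: real assume "e > 0"
    then have "\<forall>\<^sub>F k in sequentially. 1 / real (Suc k) < e"
      using LIMSEQ_inverse_real_of_nat by (auto simp: inverse_eq_divide dest: order_tendstoD)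
    then show "\<forall>\<^sub>F k in sequentially. \<forall>t\<in>{-M..M}. dist (poly (p k) t) (f t) < e"
    proof eventually_elim
      case (elim k)
      show ?case
      proof
        fix t assume "t \<in> {-M..M}"
        from p[OF this, of k] elim show "dist (poly (p k) t) (f t) < e" by (simp add: dist_real_def)
      qed
    qed
  qed
  then show ?thesis by (rule that)
qed

text \<open>The case \<open>p = 0\<close> already bounds \<open>norm (cf f a)\<close> by the supremum of \<open>\<bar>f\<bar>\<close> on the spectrum.\<close>

definition cf :: "(real \<Rightarrow> real) \<Rightarrow> 'a::cstar_algebra_1 \<Rightarrow> 'a"
  where "cf f a = (THE b. \<forall>p e. (\<forall>t\<in>rsp a. \<bar>poly p t - f t\<bar> \<le> e) \<longrightarrow> norm (reval p a - b) \<le> e)"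

context
  fixes a :: "'a::cstar_algebra_1"
  assumes sa: "star a = a"
begin

text \<open>By \<open>norm_reval_le\<close> the values of Weierstrass polynomials form a Cauchy
  sequence, and their limit satisfies every error bound. Any other candidate satisfies the bounds
  for these same polynomials and is therefore the same limit.\<close>

lemma cf_ex1:
  assumes f: "continuous_on UNIV f"
  shows "\<exists>!b. \<forall>p e. (\<forall>t\<in>rsp a. \<bar>poly p t - f t\<bar> \<le> e) \<longrightarrow> norm (reval p a - b) \<le> e"
proof -
  define M where "M = norm a"
  have sub: "rsp a \<subseteq> {-M..M}" using rsp_bound by (fastforce simp: M_def)
  obtain p where p: "uniform_limit {-M..M} (\<lambda>k. poly (p k)) f sequentially"
    using Weierstrass_seq[OF f] by blast
  have ev: "\<exists>K. \<forall>k\<ge>K. \<forall>t\<in>rsp a. \<bar>poly (p k) t - f t\<bar> < e" if "e > 0" for e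
    using uniform_limitD[OF p that] sub by (force simp: eventually_sequentially dist_real_def)
  have "Cauchy (\<lambda>k. reval (p k) a)"
    unfolding Cauchy_altdef2
  proof (intro allI impI)
    fix e :: real assume "e > 0"
    then obtain K where K: "\<And>k t. k \<ge> K \<Longrightarrow> t \<in> rsp a \<Longrightarrow> \<bar>poly (p k) t - f t\<bar> < e / 3"
      using ev[of "e/3"] by auto
    have "dist (reval (p k) a) (reval (p K) a) < e" if "k \<ge> K" for k
    proof -
      have "norm (reval (p k - p K) a) \<le> 2 * e / 3"
      proof (rule norm_reval_le[OF sa])
        fix t assume "t \<in> rsp a"
        then show "\<bar>poly (p k - p K) t\<bar> \<le> 2 * e / 3" using K[of k t] K[of K t] that unfolding poly_diff by linarith
      qed
      then show ?thesis using \<open>e > 0\<close> by (simp add: reval_diff dist_norm)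
    qed
    then show "\<exists>N. \<forall>n\<ge>N. dist (reval (p n) a) (reval (p N) a) < e" by blast
  qed
  then obtain b where b: "(\<lambda>k. reval (p k) a) \<longlonglongrightarrow> b"
    using Cauchy_convergent unfolding convergent_def by blast
  have 1: "norm (reval q a - b) \<le> e" if q: "\<forall>t\<in>rsp a. \<bar>poly q t - f t\<bar> \<le> e" for q e
  proof (rule field_le_epsilon)
    fix d :: real assume "d > 0"
    then obtain K where K: "\<And>k t. k \<ge> K \<Longrightarrow> t \<in> rsp a \<Longrightarrow> \<bar>poly (p k) t - f t\<bar> < d"
      using ev[of d] by auto
    have "norm (reval q a - reval (p k) a) \<le> e + d" if "k \<ge> K" for k
    proof -
      have "norm (reval (q - p k) a) \<le> e + d"
      proof (rule norm_reval_le[OF sa])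
        fix t assume "t \<in> rsp a"
        then show "\<bar>poly (q - p k) t\<bar> \<le> e + d" using K[of k t] q[rule_format, of t] that by auto
      qed
      then show ?thesis by (simp add: reval_diff)
    qed
    then have "\<forall>\<^sub>F k in sequentially. norm (reval q a - reval (p k) a) \<le> e + d"
      by (auto simp: eventually_sequentially)
    moreover have "(\<lambda>k. norm (reval q a - reval (p k) a)) \<longlonglongrightarrow> norm (reval q a - b)"
      using b by (intro tendsto_intros)
    ultimately show "norm (reval q a - b) \<le> e + d" by (intro tendsto_upperbound) auto
  qed
  have 2: "b' = b" if b': "\<forall>q e. (\<forall>t\<in>rsp a. \<bar>poly q t - f t\<bar> \<le> e) \<longrightarrow> norm (reval q a - b') \<le> e" for b'
  proof -
    have "(\<lambda>k. reval (p k) a) \<longlonglongrightarrow> b'"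
    proof (rule LIMSEQ_I)
      fix r :: real assume "r > 0"
      then obtain K where K: "\<And>k t. k \<ge> K \<Longrightarrow> t \<in> rsp a \<Longrightarrow> \<bar>poly (p k) t - f t\<bar> < r / 2"
        using ev[of "r / 2"] by auto
      then have "\<forall>k\<ge>K. \<forall>t\<in>rsp a. \<bar>poly (p k) t - f t\<bar> \<le> r / 2" by (metis less_imp_le)
      then have "\<forall>k\<ge>K. norm (reval (p k) a - b') \<le> r / 2" using b' by blast
      then show "\<exists>no. \<forall>n\<ge>no. norm (reval (p n) a - b') < r" using \<open>r > 0\<close>
        by (metis field_sum_of_halves le_less_trans less_add_same_cancel2 half_gt_zero)
    qed
    then show ?thesis using b LIMSEQ_unique by blast
  qed
  show ?thesis using 1 2 by (intro ex1I[of _ b]) blast+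
qed

lemma cf_approx:
  assumes "continuous_on UNIV f" "\<And>t. t \<in> rsp a \<Longrightarrow> \<bar>poly p t - f t\<bar> \<le> e"
  shows "norm (reval p a - cf f a) \<le> e"
  using theI'[OF cf_ex1[OF assms(1)]] assms(2) unfolding cf_def[symmetric] by blast

lemma cf_LIMSEQ:
  assumes "continuous_on UNIV f" "uniform_limit (rsp a) (\<lambda>k. poly (p k)) f sequentially"
  shows "(\<lambda>k. reval (p k) a) \<longlonglongrightarrow> cf f a"
proof (rule tendstoI)
  fix e :: real assume "e > 0"
  then have "\<forall>\<^sub>F k in sequentially. \<forall>t\<in>rsp a. dist (poly (p k) t) (f t) < e / 2"
    using uniform_limitD[OF assms(2), of "e/2"] by simp
  then show "\<forall>\<^sub>F k in sequentially. dist (reval (p k) a) (cf f a) < e"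
  proof eventually_elim
    case (elim k)
    then have "norm (reval (p k) a - cf f a) \<le> e / 2"
      by (intro cf_approx assms) (force simp: dist_real_def)
    then show ?case using \<open>e > 0\<close> by (simp add: dist_norm)
  qed
qed

lemma cf_seq:
  assumes "continuous_on UNIV f"
  obtains p where "uniform_limit (rsp a) (\<lambda>k. poly (p k)) f sequentially"
    "(\<lambda>k. reval (p k) a) \<longlonglongrightarrow> cf f a"
proof -
  obtain p where p: "uniform_limit {- norm a..norm a} (\<lambda>k. poly (p k)) f sequentially"
    using Weierstrass_seq[OF assms] by blast
  moreover have "rsp a \<subseteq> {- norm a..norm a}" using rsp_bound by fastforce
  ultimately have "uniform_limit (rsp a) (\<lambda>k. poly (p k)) f sequentially"
    using uniform_limit_on_subset by blast
  then show ?thesis using that cf_LIMSEQ[OF assms] by blast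
qed

lemma cf_poly: "cf (poly p) a = reval p a"
  using cf_approx[of "poly p" p 0] by (simp add: continuous_on_poly)

lemma cf_const: "cf (\<lambda>t. c) a = c *\<^sub>R 1"
proof -
  have "poly [:c:] = (\<lambda>t::real. c)" by auto
  then show ?thesis using cf_poly[of "[:c:]"] by (simp add: reval_simps)
qed

lemma cf_ident: "cf (\<lambda>t. t) a = a"
proof -
  have "poly [:0,1:] = (\<lambda>t::real. t)" by auto
  then show ?thesis using cf_poly[of "[:0,1:]"] by (simp add: reval_simps)
qed

lemma cf_cong: "(\<And>t. t \<in> rsp a \<Longrightarrow> f t = g t) \<Longrightarrow> cf f a = cf g a"
  unfolding cf_def by (simp cong: ball_cong)

lemma star_cf:
  assumes "continuous_on UNIV f"
  shows "star (cf f a) = cf f a"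
proof -
  obtain p where p: "(\<lambda>k. reval (p k) a) \<longlonglongrightarrow> cf f a" using cf_seq[OF assms] by blast
  from tendsto_star[OF this] have "(\<lambda>k. reval (p k) a) \<longlonglongrightarrow> star (cf f a)"
    by (simp add: star_reval sa)
  with p show ?thesis using LIMSEQ_unique by blast
qed

lemma cf_add:
  assumes "continuous_on UNIV f" "continuous_on UNIV g"
  shows "cf (\<lambda>t. f t + g t) a = cf f a + cf g a"
proof -
  obtain p where p: "uniform_limit (rsp a) (\<lambda>k. poly (p k)) f sequentially"
    "(\<lambda>k. reval (p k) a) \<longlonglongrightarrow> cf f a" using cf_seq[OF assms(1)] by blast
  obtain q where q: "uniform_limit (rsp a) (\<lambda>k. poly (q k)) g sequentially"
    "(\<lambda>k. reval (q k) a) \<longlonglongrightarrow> cf g a" using cf_seq[OF assms(2)] by blast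
  have "(\<lambda>k. reval (p k + q k) a) \<longlonglongrightarrow> cf (\<lambda>t. f t + g t) a"
    using uniform_limit_add[OF p(1) q(1)] assms by (intro cf_LIMSEQ continuous_intros) (auto simp: poly_add[abs_def])
  moreover have "(\<lambda>k. reval (p k + q k) a) \<longlonglongrightarrow> cf f a + cf g a"
    unfolding reval_simps using p q by (intro tendsto_intros)
  ultimately show ?thesis using LIMSEQ_unique by blast
qed

lemma bounded_image_rsp:
  assumes "continuous_on UNIV f"
  shows "bounded (f ` rsp a)"
proof -
  have "bounded (f ` {- norm a..norm a})"
    using assms by (intro compact_imp_bounded compact_continuous_image) (auto elim: continuous_on_subset)
  moreover have "rsp a \<subseteq> {- norm a..norm a}" using rsp_bound by fastforce
  ultimately show ?thesis by (meson bounded_subset image_mono)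
qed

lemma cf_mult:
  assumes "continuous_on UNIV f" "continuous_on UNIV g"
  shows "cf (\<lambda>t. f t * g t) a = cf f a * cf g a"
proof -
  obtain p where p: "uniform_limit (rsp a) (\<lambda>k. poly (p k)) f sequentially"
    "(\<lambda>k. reval (p k) a) \<longlonglongrightarrow> cf f a" using cf_seq[OF assms(1)] by blast
  obtain q where q: "uniform_limit (rsp a) (\<lambda>k. poly (q k)) g sequentially"
    "(\<lambda>k. reval (q k) a) \<longlonglongrightarrow> cf g a" using cf_seq[OF assms(2)] by blast
  have "(\<lambda>k. reval (p k * q k) a) \<longlonglongrightarrow> cf (\<lambda>t. f t * g t) a"
    using uniform_lim_mult[OF p(1) q(1)] assms
    by (intro cf_LIMSEQ continuous_intros) (auto simp: bounded_image_rsp poly_mult[abs_def])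
  moreover have "(\<lambda>k. reval (p k * q k) a) \<longlonglongrightarrow> cf f a * cf g a"
    unfolding reval_simps using p q by (intro tendsto_intros)
  ultimately show ?thesis using LIMSEQ_unique by blast
qed

lemma cf_scaleR:
  assumes "continuous_on UNIV f"
  shows "cf (\<lambda>t. c * f t) a = c *\<^sub>R cf f a"
  using cf_mult[of "\<lambda>t. c" f] assms by (simp add: cf_const)

lemma cf_minus:
  assumes "continuous_on UNIV f"
  shows "cf (\<lambda>t. - f t) a = - cf f a"
  using cf_scaleR[of f "-1"] assms by simp

lemma cf_diff:
  assumes "continuous_on UNIV f" "continuous_on UNIV g"
  shows "cf (\<lambda>t. f t - g t) a = cf f a - cf g a"
  using cf_add[of f "\<lambda>t. - g t"] assms by (simp add: cf_minus continuous_intros)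

lemma norm_cf_le:
  assumes "continuous_on UNIV f" "\<And>t. t \<in> rsp a \<Longrightarrow> \<bar>f t\<bar> \<le> e"
  shows "norm (cf f a) \<le> e"
  using cf_approx[of f 0 e] assms by (simp add: reval_simps)

lemma norm_cf_diff_le:
  assumes "continuous_on UNIV f" "continuous_on UNIV g" "\<And>t. t \<in> rsp a \<Longrightarrow> \<bar>f t - g t\<bar> \<le> e"
  shows "norm (cf f a - cf g a) \<le> e"
  unfolding cf_diff[OF assms(1,2), symmetric] using assms by (intro norm_cf_le continuous_intros)

end

text \<open>Polynomials that are good on one interval containing both \<open>rsp (cf f a)\<close> and the values of
  \<open>f\<close> make the spectral mapping theorem for \<open>f\<close> unnecessary.\<close>

lemma cf_comp:
  assumes sa: "star a = (a::'a::cstar_algebra_1)"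
    and f: "continuous_on UNIV f" and g: "continuous_on UNIV g"
  shows "cf g (cf f a) = cf (\<lambda>t. g (f t)) a"
proof -
  note sf = star_cf[OF sa f]
  obtain B where B: "\<And>t. t \<in> rsp a \<Longrightarrow> \<bar>f t\<bar> \<le> B"
    using bounded_image_rsp[OF sa f] unfolding bounded_iff by auto
  define M where "M = max B (norm (cf f a))"
  have gf: "continuous_on UNIV (\<lambda>t. g (f t))"
    using continuous_on_compose[OF f continuous_on_subset[OF g]] by (simp add: o_def)
  have pf: "cf (\<lambda>t. poly p (f t)) a = reval p (cf f a)" for p
  proof (induction p)
    case 0 then show ?case using cf_const[OF sa, of 0] by (simp add: reval_simps)
  next
    case (pCons c p)
    have "continuous_on UNIV (\<lambda>t. poly p (f t))" 
      using f by (intro continuous_intros)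
    then show ?case using pCons f
      by (simp add: reval_simps cf_add[OF sa] cf_mult[OF sa] cf_const[OF sa] continuous_intros)
  qed
  have "norm (cf g (cf f a) - cf (\<lambda>t. g (f t)) a) \<le> e" if e: "e > 0" for e
  proof -
    obtain p where p: "\<And>t. t \<in> {-M..M} \<Longrightarrow> \<bar>poly p t - g t\<bar> < e / 2"
      using Weierstrass_poly[of "-M" M g "e/2"] continuous_on_subset[OF g subset_UNIV] e
      by (meson half_gt_zero)
    have "norm (reval p (cf f a) - cf g (cf f a)) \<le> e / 2"
    proof (rule cf_approx[OF sf g])
      fix t assume "t \<in> rsp (cf f a)"
      then have "t \<in> {-M..M}" using rsp_bound[of t "cf f a"] by (auto simp: M_def)
      then show "\<bar>poly p t - g t\<bar> \<le> e / 2" using p by (simp add: less_imp_le)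
    qed
    moreover have "norm (cf (\<lambda>t. poly p (f t)) a - cf (\<lambda>t. g (f t)) a) \<le> e / 2"
    proof (rule norm_cf_diff_le[OF sa _ gf])
      show "continuous_on UNIV (\<lambda>t. poly p (f t))" using f by (intro continuous_intros)
      fix t assume "t \<in> rsp a"
      then have "f t \<in> {-M..M}" using B[of t] by (auto simp: M_def)
      then show "\<bar>poly p (f t) - g (f t)\<bar> \<le> e / 2" using p by (simp add: less_imp_le)
    qed
    ultimately have "norm (cf g (cf f a) - reval p (cf f a)) \<le> e / 2"
      "norm (reval p (cf f a) - cf (\<lambda>t. g (f t)) a) \<le> e / 2"
      by (simp_all only: pf norm_minus_commute)
    from norm_diff_triangle_le[OF this] show ?thesis by (simp only: field_sum_of_halves)
  qed
  then have "norm (cf g (cf f a) - cf (\<lambda>t. g (f t)) a) \<le> 0"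
    by (rule field_le_epsilon) (simp only: add_0)
  then show ?thesis by simp
qed

section \<open>Positivity and the Loewner-Heinz inequality\<close>

definition pos :: "'a::cstar_algebra_1 \<Rightarrow> bool"
  where "pos a \<longleftrightarrow> star a = a \<and> (\<forall>t\<in>rsp a. 0 \<le> t)"

lemma pos_selfadjoint: "pos a \<Longrightarrow> star a = a"
  by (simp add: pos_def)

lemma star_scaleR_one [simp]: "star (r *\<^sub>R (1::'a::cstar_algebra_1)) = r *\<^sub>R 1"
  by (simp add: star_scaleR)

lemma rsp_diff: "t \<in> rsp (r *\<^sub>R 1 - a) \<longleftrightarrow> r - t \<in> rsp a"
  by (simp add: rsp_def usp_of_real_diff)

lemma rsp_shift: "t \<in> rsp (a + r *\<^sub>R 1) \<longleftrightarrow> t - r \<in> rsp a"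
  using usp_shift[of "of_real t" a "of_real r"] by (simp add: rsp_def scaleC_of_real)

lemma norm_le_rsp:
  assumes "star a = a" "\<And>t. t \<in> rsp a \<Longrightarrow> \<bar>t\<bar> \<le> r"
  shows "norm a \<le> r"
  using norm_cf_le[OF assms(1), of "\<lambda>t. t" r] assms by (simp add: cf_ident)

text \<open>Trades a spectral condition, which behaves badly under sums and limits, for a norm
  inequality: the triangle inequality then gives \<open>pos_add\<close>, and continuity of the norm
  gives \<open>pos_LIMSEQ\<close>.\<close>

lemma pos_iff_norm:
  assumes sa: "star a = (a::'a::cstar_algebra_1)" and M: "norm a \<le> M"
  shows "pos a \<longleftrightarrow> norm (M *\<^sub>R 1 - a) \<le> M"
proof
  assume p: "pos a"
  show "norm (M *\<^sub>R 1 - a) \<le> M"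
  proof (rule norm_le_rsp)
    show "star (M *\<^sub>R 1 - a) = M *\<^sub>R 1 - a" using sa by (simp add: star_diff)
    fix t assume "t \<in> rsp (M *\<^sub>R 1 - a)"
    then have "M - t \<in> rsp a" by (simp add: rsp_diff)
    with p rsp_bound[of "M - t" a] M show "\<bar>t\<bar> \<le> M" by (auto simp: pos_def)
  qed
next
  assume n: "norm (M *\<^sub>R 1 - a) \<le> M"
  have "0 \<le> t" if "t \<in> rsp a" for t
  proof -
    have "M - t \<in> rsp (M *\<^sub>R 1 - a)" using that by (simp add: rsp_diff)
    then show ?thesis using rsp_bound[of "M - t" "M *\<^sub>R 1 - a"] n by simp
  qed
  with sa show "pos a" by (simp add: pos_def)
qed

lemma pos_add:
  assumes "pos a" "pos b"
  shows "pos (a + b)"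
proof -
  have sa: "star a = a" "star b = b" "star (a + b) = a + b"
    using assms by (auto simp: pos_def star_add)
  have "norm (norm a *\<^sub>R 1 - a) \<le> norm a" "norm (norm b *\<^sub>R 1 - b) \<le> norm b"
    using assms pos_iff_norm[OF sa(1) order_refl] pos_iff_norm[OF sa(2) order_refl] by auto
  then have "norm ((norm a *\<^sub>R 1 - a) + (norm b *\<^sub>R 1 - b)) \<le> norm a + norm b"
    by (rule norm_triangle_mono)
  then have "norm ((norm a + norm b) *\<^sub>R 1 - (a + b)) \<le> norm a + norm b"
    by (simp add: algebra_simps)
  then show ?thesis using pos_iff_norm[OF sa(3) norm_triangle_ineq] by blast
qed

lemma pos_cf:
  assumes sa: "star a = a" and f: "continuous_on UNIV f" "\<And>t. t \<in> rsp a \<Longrightarrow> 0 \<le> f t"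
  shows "pos (cf f a)"
proof -
  obtain B where B: "\<And>t. t \<in> rsp a \<Longrightarrow> \<bar>f t\<bar> \<le> B"
    using bounded_image_rsp[OF sa f(1)] unfolding bounded_iff by auto
  have "norm (cf f a) \<le> B" using B by (intro norm_cf_le sa f)
  moreover have "norm (cf (\<lambda>t. B - f t) a) \<le> B"
    using B f by (intro norm_cf_le sa continuous_intros) (auto simp: abs_le_iff)
  then have "norm (B *\<^sub>R 1 - cf f a) \<le> B"
    using f by (simp add: cf_diff[OF sa] cf_const[OF sa])
  ultimately show ?thesis using pos_iff_norm[OF star_cf[OF sa f(1)]] by blast
qed

lemma pos_cf_diff:
  assumes "star a = a" "continuous_on UNIV f" "continuous_on UNIV g"
    "\<And>t. t \<in> rsp a \<Longrightarrow> f t \<le> g t"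
  shows "pos (cf g a - cf f a)"
  unfolding cf_diff[OF assms(1,3,2), symmetric] using assms by (intro pos_cf continuous_intros) auto

lemma pos_scaleR:
  assumes "pos a" "r \<ge> 0"
  shows "pos (r *\<^sub>R a)"
proof -
  have "pos (cf (\<lambda>t. r * t) a)"
    using assms by (intro pos_cf continuous_intros) (auto simp: pos_def)
  then show ?thesis using pos_selfadjoint[OF assms(1)] by (simp add: cf_scaleR cf_ident)
qed

lemma pos_0 [simp]: "pos 0"
  using pos_iff_norm[of 0 0] by simp

lemma pos_1 [simp]: "pos 1"
  using pos_iff_norm[of 1 1] by simp

lemma pos_scaleR_1 [simp]: "r \<ge> 0 \<Longrightarrow> pos (r *\<^sub>R 1)"
  by (simp add: pos_scaleR)

lemma pos_sum: "(\<And>i. i \<in> S \<Longrightarrow> pos (f i)) \<Longrightarrow> pos (sum f S)"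
  by (induction S rule: infinite_finite_induct) (auto simp: pos_add)

lemma pos_square:
  assumes "star a = a"
  shows "pos (a * a)"
proof -
  have "pos (cf (\<lambda>t. t * t) a)" using assms by (intro pos_cf continuous_intros) auto
  then show ?thesis using assms by (simp add: cf_mult cf_ident)
qed

lemma pos_norm_diff:
  assumes "star a = a" "norm a \<le> r"
  shows "pos (r *\<^sub>R 1 - a)"
proof -
  have "pos (cf (\<lambda>t. r - t) a)"
    using assms rsp_bound[of _ a] by (intro pos_cf continuous_intros) force+
  then show ?thesis using assms by (simp add: cf_diff cf_ident cf_const)
qed

lemma norm_le_pos:
  assumes "pos a" "pos (r *\<^sub>R 1 - a)"
  shows "norm a \<le> r"
proof (rule norm_le_rsp)
  fix t assume t: "t \<in> rsp a"
  then have "r - t \<in> rsp (r *\<^sub>R 1 - a)" by (simp add: rsp_diff)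
  with t assms show "\<bar>t\<bar> \<le> r" by (auto simp: pos_def)
qed (use assms pos_def in auto)

lemma pos_mono_norm:
  assumes "pos a" "pos (b - a)"
  shows "norm a \<le> norm b"
proof -
  have "pos b" using pos_add[OF assms] by simp
  then have "pos (norm b *\<^sub>R 1 - b)" by (intro pos_norm_diff pos_selfadjoint) auto
  from pos_add[OF this assms(2)] show ?thesis by (intro norm_le_pos assms) (simp add: algebra_simps)
qed

lemma pos_antisym:
  assumes "pos a" "pos (- a)"
  shows "a = 0"
  using norm_le_pos[of a 0] assms by simp

lemma pos_LIMSEQ:
  assumes "X \<longlonglongrightarrow> a" "\<And>k. pos (X k)"
  shows "pos a"
proof -
  \<comment> \<open>Strictly above \<open>norm a\<close>, so that it eventually bounds
    \<open>norm (X k)\<close> too and \<open>pos_iff_norm\<close> applies with a single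
    constant.\<close>
  define M where "M = norm a + 1"
  have "(\<lambda>k. star (X k)) \<longlonglongrightarrow> star a" using assms(1) by (rule tendsto_star)
  then have "X \<longlonglongrightarrow> star a" using assms(2) by (simp add: pos_def)
  then have sa: "star a = a" using assms(1) LIMSEQ_unique by blast
  have "(\<lambda>k. norm (X k)) \<longlonglongrightarrow> norm a" using assms(1) by (rule tendsto_norm)
  then have "\<forall>\<^sub>F k in sequentially. norm (X k) < M"
    by (rule order_tendstoD) (simp add: M_def)
  then have "\<forall>\<^sub>F k in sequentially. norm (M *\<^sub>R 1 - X k) \<le> M"
  proof eventually_elim
    case (elim k)
    then show ?case using pos_iff_norm[of "X k" M] assms(2)[of k] pos_selfadjoint by force
  qed
  moreover have "(\<lambda>k. norm (M *\<^sub>R 1 - X k)) \<longlonglongrightarrow> norm (M *\<^sub>R 1 - a)"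
    using assms(1) by (intro tendsto_intros)
  ultimately have "norm (M *\<^sub>R 1 - a) \<le> M" by (intro tendsto_upperbound) auto
  then show ?thesis using pos_iff_norm[OF sa, of M] by (simp add: M_def)
qed

lemma selfadjoint_decomp:
  obtains u v where "star u = u" "star v = v" "(x::'a::cstar_algebra_1) = u + \<i> *\<^sub>C v"
proof
  define u where "u = (1/2::complex) *\<^sub>C (x + star x)"
  define v where "v = (- \<i> / 2) *\<^sub>C (x - star x)"
  show "star u = u" "star v = v"
    by (simp_all add: u_def v_def star_add star_diff star_scaleC star_star add.commute
        cvec.scale_right_diff_distrib)
  have "\<i> *\<^sub>C v = (1/2::complex) *\<^sub>C (x - star x)"
    by (simp add: v_def scaleC_scaleC flip: mult.assoc)
  then have "u + \<i> *\<^sub>C v = (1/2::complex) *\<^sub>C (2 *\<^sub>R x)"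
    unfolding u_def by (simp only: flip: scaleC_add_right) (simp add: scaleR_2)
  also have "\<dots> = x" by (simp add: scaleC_scaleC flip: scaleC_of_real)
  finally show "x = u + \<i> *\<^sub>C v" by simp
qed

lemma pos_usp_mult_commute:
  assumes "pos (x * y)" "star (y * x) = y * x"
  shows "pos (y * x)"
proof -
  have "0 \<le> t" if "t \<in> rsp (y * x)" for t
  proof (cases "t = 0")
    case False
    then have "t \<in> rsp (x * y)" using that usp_mult_commute[of "of_real t" y x] by (simp add: rsp_def)
    then show ?thesis using assms(1) by (simp add: pos_def)
  qed auto
  then show ?thesis using assms(2) by (simp add: pos_def)
qed

text \<open>The classical trick: with \<open>y = x k\<close>, where \<open>k\<^sup>2\<close> is the negative part of \<open>h = x\<^sup>* x\<close>, the
  element \<open>y\<^sup>* y\<close> is negative, whereas \<open>y\<^sup>* y + y y\<^sup>*\<close> is positive and \<open>- y y\<^sup>*\<close> has the same nonzero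
  spectrum as \<open>- y\<^sup>* y\<close>.\<close>

lemma pos_star_mult: "pos (star x * (x::'a::cstar_algebra_1))"
proof -
  define h where "h = star x * x"
  have sa: "star h = h" by (simp add: h_def star_mult star_star)
  define g where "g t = max (- t) 0" for t :: real
  define k where "k = cf (\<lambda>t. sqrt (g t)) h"
  have cg: "continuous_on UNIV g" unfolding g_def by (intro continuous_intros)
  have ck: "continuous_on UNIV (\<lambda>t. sqrt (g t))" using cg by (intro continuous_intros)
  have sk: "star k = k" unfolding k_def by (rule star_cf[OF sa ck])
  define y where "y = x * k"
  have "star y * y = k * h * k" by (simp add: y_def h_def star_mult sk mult.assoc)
  also have "\<dots> = cf (\<lambda>t. sqrt (g t) * t * sqrt (g t)) h"
    unfolding k_def using ck by (simp add: cf_mult[OF sa] cf_ident[OF sa] continuous_intros)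
  also have "(\<lambda>t. sqrt (g t) * t * sqrt (g t)) = (\<lambda>t. - (g t * g t))"
  proof
    fix t
    have "sqrt (g t) * t * sqrt (g t) = t * (sqrt (g t) * sqrt (g t))" by (simp only: mult_ac)
    also have "\<dots> = t * g t" by (simp add: g_def)
    also have "\<dots> = - (g t * g t)" by (simp add: g_def max_def)
    finally show "sqrt (g t) * t * sqrt (g t) = - (g t * g t)" .
  qed
  also have "cf (\<lambda>t. - (g t * g t)) h = - (cf g h * cf g h)"
    using cg by (simp add: cf_minus[OF sa] cf_mult[OF sa] continuous_intros)
  finally have yy: "star y * y = - (cf g h * cf g h)" .
  have sg: "star (cf g h) = cf g h" by (rule star_cf[OF sa cg])
  have p1: "pos (- (star y * y))" using pos_square[OF sg] yy by simp
  have p2: "pos (- (y * star y))"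
    using pos_usp_mult_commute[of "- star y" y] p1 by (simp add: star_mult star_star star_minus)
  obtain u v where uv: "star u = u" "star v = v" "y = u + \<i> *\<^sub>C v" by (rule selfadjoint_decomp)
  have "star y = u - \<i> *\<^sub>C v" using uv by (simp add: star_add star_scaleC)
  then have "star y * y + y * star y = 2 *\<^sub>R (u * u + v * v)"
    unfolding \<open>star y = u - \<i> *\<^sub>C v\<close> unfolding uv(3)
    by (simp add: algebra_simps mult_scaleC_left mult_scaleC_right scaleC_scaleC scaleR_2)
  moreover have "pos (2 *\<^sub>R (u * u + v * v))" using uv by (intro pos_scaleR pos_add pos_square) auto
  ultimately have "pos ((star y * y + y * star y) + (- (y * star y)))" using p2 pos_add by metis
  then have "pos (star y * y)" by simp
  \<comment> \<open>By \<open>yy\<close> this product is minus the square of the negative part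
    \<open>cf g h\<close>, which must therefore vanish.\<close>
  then have "star y * y = 0" using p1 by (rule pos_antisym)
  then have "(norm (cf g h))\<^sup>2 = 0" using yy cstar_identity[of "cf g h"] sg by simp
  then have "cf g h = 0" by simp
  have "pos (cf (\<lambda>t. max t 0) h)" using sa by (intro pos_cf continuous_intros) auto
  moreover have "(\<lambda>t. max t 0) = (\<lambda>t. t + g t)" by (auto simp: g_def)
  ultimately have "pos (cf (\<lambda>t. t + g t) h)" by simp
  then show ?thesis using cg \<open>cf g h = 0\<close> unfolding h_def[symmetric]
    by (simp add: cf_add[OF sa] cf_ident[OF sa])
qed

lemma pos_sqrt:
  assumes "pos a"
  obtains b where "star b = b" "a = b * b"
proof
  note sa = pos_selfadjoint[OF assms]
  let ?f = "\<lambda>t. sqrt (max t 0)"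
  have c: "continuous_on UNIV ?f" by (intro continuous_intros)
  show "star (cf ?f a) = cf ?f a" by (rule star_cf[OF sa c])
  have "cf ?f a * cf ?f a = cf (\<lambda>t. ?f t * ?f t) a" using cf_mult[OF sa c c] by simp
  also have "\<dots> = cf (\<lambda>t. t) a" using assms by (intro cf_cong[OF sa]) (auto simp: pos_def)
  finally show "a = cf ?f a * cf ?f a" by (simp add: cf_ident[OF sa])
qed

lemma pos_conj:
  assumes "pos a"
  shows "pos (star x * a * x)"
proof -
  obtain b where b: "star b = b" "a = b * b" using pos_sqrt[OF assms] .
  have "star x * a * x = star (b * x) * (b * x)" using b by (simp add: star_mult mult.assoc)
  then show ?thesis by (simp add: pos_star_mult)
qed

lemma pos_conj_diff:
  assumes "pos (b - a)"
  shows "pos (star x * b * x - star x * a * x)"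
  using pos_conj[OF assms, of x] by (simp add: algebra_simps)

section \<open>The Loewner-Heinz inequality\<close>

text \<open>The points of \<open>E\<close> nearest to a missing \<open>x\<close> on its two sides
  enclose a gap, yet their midpoint lies in \<open>E\<close>. Applied to the set of exponents for
  which the power is operator monotone, which contains \<open>0\<close> and
  \<open>1\<close>.\<close>

lemma closed_midpoint_full:
  fixes E :: "real set"
  assumes E: "closed E" "0 \<in> E" "1 \<in> E" and mid: "\<And>x y. x \<in> E \<Longrightarrow> y \<in> E \<Longrightarrow> (x + y) / 2 \<in> E"
    and x: "x \<in> {0..1}"
  shows "x \<in> E"
proof (rule ccontr)
  assume nx: "x \<notin> E"
  define A where "A = E \<inter> {..x}"
  define B where "B = E \<inter> {x..}"
  have A: "closed A" "A \<noteq> {}" "bdd_above A" and B: "closed B" "B \<noteq> {}" "bdd_below B"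
    using E x by (auto simp: A_def B_def intro!: closed_Int bdd_aboveI[of _ x] bdd_belowI[of _ x])
  have l: "Sup A \<in> A" using closed_contains_Sup A by blast
  have u: "Inf B \<in> B" using closed_contains_Inf B by blast
  define m where "m = (Sup A + Inf B) / 2"
  have m: "m \<in> E" unfolding m_def using l u by (intro mid) (auto simp: A_def B_def)
  have lx: "Sup A < x" "x < Inf B" using l u nx by (auto simp: A_def B_def less_le)
  show False
  proof (cases "m \<le> x")
    case True
    then have "m \<le> Sup A" using m A(3) by (intro cSup_upper) (auto simp: A_def)
    then show False using lx by (simp add: m_def)
  next
    case False
    then have "Inf B \<le> m" using m B(3) by (intro cInf_lower) (auto simp: B_def)
    then show False using lx by (simp add: m_def)
  qed
qed

text \<open>For \<open>d > 0\<close> this is continuous on the whole line even if the exponent is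
  negative, and it agrees with the true power on \<open>{d..}\<close>, in particular on the spectrum
  of an element bounded below by \<open>d\<close>.\<close>

definition pw :: "real \<Rightarrow> real \<Rightarrow> real \<Rightarrow> real"
  where "pw d \<alpha> t = max t d powr \<alpha>"

context
  fixes d :: real
  assumes d: "d > 0"
begin

lemma continuous_on_pw: "continuous_on UNIV (pw d \<alpha>)"
  unfolding pw_def using d by (intro continuous_intros) auto

lemma pw_add: "pw d (\<alpha> + \<beta>) t = pw d \<alpha> t * pw d \<beta> t"
  by (simp add: pw_def powr_add)

context
  fixes a :: "'a::cstar_algebra_1"
  assumes a: "pos (a - d *\<^sub>R 1)"
begin

lemma pos_lower_selfadjoint: "star a = a"
  using pos_selfadjoint[OF a] by (simp add: star_diff)

lemma pos_lower_rsp: "t \<in> rsp a \<Longrightarrow> d \<le> t"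
  using a rsp_shift[of "t - d" a "- d"] by (auto simp: pos_def)

lemma cf_pw_mult: "cf (pw d \<alpha>) a * cf (pw d \<beta>) a = cf (pw d (\<alpha> + \<beta>)) a"
  using cf_mult[OF pos_lower_selfadjoint continuous_on_pw continuous_on_pw, of \<alpha> \<beta>]
  by (simp add: pw_add[abs_def])

lemma cf_pw_0: "cf (pw d 0) a = 1"
proof -
  have "cf (pw d 0) a = cf (\<lambda>t. 1) a"
    using d by (intro cf_cong pos_lower_selfadjoint) (auto simp: pw_def)
  then show ?thesis using cf_const[OF pos_lower_selfadjoint, of 1] by simp
qed

lemma cf_pw_1: "cf (pw d 1) a = a"
proof -
  have "cf (pw d 1) a = cf (\<lambda>t. t) a"
    using d pos_lower_rsp by (intro cf_cong pos_lower_selfadjoint) (force simp: pw_def)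
  then show ?thesis using cf_ident[OF pos_lower_selfadjoint] by simp
qed

lemma star_cf_pw: "star (cf (pw d \<alpha>) a) = cf (pw d \<alpha>) a"
  by (rule star_cf[OF pos_lower_selfadjoint continuous_on_pw])

text \<open>Joint continuity of the power in exponent and base is uniform on a compact rectangle
  containing the spectrum. This makes the set of admissible exponents closed.\<close>

lemma cf_pw_tendsto:
  assumes "\<alpha> \<longlonglongrightarrow> \<beta>"
  shows "(\<lambda>k. cf (pw d (\<alpha> k)) a) \<longlonglongrightarrow> cf (pw d \<beta>) a"
proof (rule tendstoI)
  fix e :: real assume e: "e > 0"
  define M where "M = norm a"
  define F where "F p = max (snd p) d powr fst p" for p :: "real \<times> real"
  define K where "K = {\<beta> - 1..\<beta> + 1} \<times> {-M..M}"
  have "continuous_on K F" unfolding F_def using d by (intro continuous_intros) auto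
  then have "uniformly_continuous_on K F"
    by (rule compact_uniformly_continuous) (auto simp: K_def intro: compact_Times)
  then obtain r where r: "r > 0" "\<And>p q. \<lbrakk>p \<in> K; q \<in> K; dist q p < r\<rbrakk> \<Longrightarrow> dist (F q) (F p) < e / 2"
    unfolding uniformly_continuous_on_def using e by (metis half_gt_zero)
  have "\<forall>\<^sub>F k in sequentially. dist (\<alpha> k) \<beta> < min r 1"
    using tendstoD[OF assms, of "min r 1"] r(1) by simp
  then show "\<forall>\<^sub>F k in sequentially. dist (cf (pw d (\<alpha> k)) a) (cf (pw d \<beta>) a) < e"
  proof eventually_elim
    case (elim k)
    have "norm (cf (pw d (\<alpha> k)) a - cf (pw d \<beta>) a) \<le> e / 2"
    proof (rule norm_cf_diff_le[OF pos_lower_selfadjoint continuous_on_pw continuous_on_pw])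
      fix t assume "t \<in> rsp a"
      then have t: "t \<in> {-M..M}" using rsp_bound[of t a] by (auto simp: M_def)
      have "dist (F (\<alpha> k, t)) (F (\<beta>, t)) < e / 2"
        using elim t by (intro r(2)) (auto simp: K_def dist_real_def dist_prod_def abs_less_iff)
      then show "\<bar>pw d (\<alpha> k) t - pw d \<beta> t\<bar> \<le> e / 2" by (simp add: F_def pw_def dist_real_def)
    qed
    then show ?case using e by (simp add: dist_norm)
  qed
qed

end

context
  fixes a b :: "'a::cstar_algebra_1"
  assumes a: "pos (a - d *\<^sub>R 1)" and ab: "pos (b - a)"
begin

lemma pos_lower_trans: "pos (b - d *\<^sub>R 1)"
  using pos_add[OF a ab] by simp

text \<open>Conjugating the inequality between the powers of \<open>a\<close> and \<open>b\<close>
  by \<open>cf (pw d (- \<alpha> / 2)) b\<close> bounds \<open>star ?w * ?w\<close> by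
  \<open>1\<close>.\<close>

lemma norm_pw_quotient_le:
  assumes "pos (cf (pw d \<alpha>) b - cf (pw d \<alpha>) a)"
  shows "norm (cf (pw d (\<alpha> / 2)) a * cf (pw d (- \<alpha> / 2)) b) \<le> 1"
proof -
  note b = pos_lower_trans
  let ?w = "cf (pw d (\<alpha> / 2)) a * cf (pw d (- \<alpha> / 2)) b"
  let ?r = "cf (pw d (- \<alpha> / 2)) b"
  have e1: "star ?w * ?w = star ?r * cf (pw d \<alpha>) a * ?r"
    using cf_pw_mult[OF a, of "\<alpha> / 2" "\<alpha> / 2"]
    by (simp add: star_mult star_cf_pw[OF a] star_cf_pw[OF b] mult.assoc flip: mult.assoc[of "cf (pw d (\<alpha>/2)) a"])
  have "star ?r * cf (pw d \<alpha>) b * ?r = 1"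
    using cf_pw_0[OF b] by (simp add: star_cf_pw[OF b] cf_pw_mult[OF b])
  then have "pos (1 *\<^sub>R 1 - star ?w * ?w)"
    using pos_conj_diff[OF assms, of ?r] by (simp only: e1 scaleR_one)
  then have "norm (star ?w * ?w) \<le> 1" by (intro norm_le_pos pos_star_mult)
  then have "(norm ?w)\<^sup>2 \<le> 1\<^sup>2" by (simp only: cstar_identity power_one)
  then show ?thesis by (rule power2_le_imp_le) simp
qed

text \<open>The contractions for \<alpha> and \<beta> combine to a contraction k = b^(-\<alpha>/2)
  a^\<gamma> b^(-\<beta>/2). It is similar to the self-adjoint h = b^(-\<gamma>/2) a^\<gamma>
  b^(-\<gamma>/2), whose spectrum thus stays below 1. Hence h \<le> 1, and conjugation by
  b^(\<gamma>/2) gives the claim.\<close>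

lemma Loewner_Heinz_midpoint:
  assumes "pos (cf (pw d \<alpha>) b - cf (pw d \<alpha>) a)" "pos (cf (pw d \<beta>) b - cf (pw d \<beta>) a)"
  shows "pos (cf (pw d ((\<alpha> + \<beta>) / 2)) b - cf (pw d ((\<alpha> + \<beta>) / 2)) a)"
proof -
  note b = pos_lower_trans
  define P where "P \<gamma> = cf (pw d \<gamma>) a" for \<gamma>
  define Q where "Q \<gamma> = cf (pw d \<gamma>) b" for \<gamma>
  have PP: "P x * P y = P (x + y)" "P x * (P y * z) = P (x + y) * z" for x y z
    using cf_pw_mult[OF a] by (simp_all add: P_def flip: mult.assoc)
  have QQ: "Q x * Q y = Q (x + y)" "Q x * (Q y * z) = Q (x + y) * z" for x y z
    using cf_pw_mult[OF b] by (simp_all add: Q_def flip: mult.assoc)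
  have Q0: "Q 0 = 1" using cf_pw_0[OF b] by (simp add: Q_def)
  have sP: "star (P x) = P x" and sQ: "star (Q x) = Q x" for x
    using star_cf_pw[OF a] star_cf_pw[OF b] by (auto simp: P_def Q_def)
  define \<gamma> where "\<gamma> = (\<alpha> + \<beta>) / 2"
  define k where "k = star (P (\<alpha> / 2) * Q (- \<alpha> / 2)) * (P (\<beta> / 2) * Q (- \<beta> / 2))"
  have "norm k \<le> norm (P (\<alpha> / 2) * Q (- \<alpha> / 2)) * norm (P (\<beta> / 2) * Q (- \<beta> / 2))"
    unfolding k_def using norm_mult_ineq norm_star by metis
  also have "\<dots> \<le> 1 * 1"
    unfolding P_def Q_def using assms by (intro mult_mono norm_pw_quotient_le) auto
  finally have nk: "norm k \<le> 1" by simp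
  have k: "k = Q (- \<alpha> / 2) * P \<gamma> * Q (- \<beta> / 2)"
    by (simp add: k_def star_mult sP sQ mult.assoc PP \<gamma>_def add_divide_distrib)
  define h where "h = Q (- \<gamma> / 2) * P \<gamma> * Q (- \<gamma> / 2)"
  \<comment> \<open>Moves the left exponent of \<open>k\<close> to \<open>- \<gamma> / 2\<close>;
    the right one becomes \<open>- \<gamma> / 2\<close> as well because \<open>\<gamma>\<close> is
    the midpoint.\<close>
  define s where "s = (\<alpha> - \<gamma>) / 2"
  have "Q s * k * Q (- s) = Q (s - \<alpha> / 2) * P \<gamma> * Q (- \<beta> / 2 - s)"
    by (simp add: k mult.assoc QQ)
  moreover have "s - \<alpha> / 2 = - \<gamma> / 2" "- \<beta> / 2 - s = - \<gamma> / 2"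
    by (simp_all add: s_def \<gamma>_def field_simps)
  ultimately have h: "h = Q s * k * Q (- s)" by (simp only: h_def)
  have sub: "usp h \<subseteq> usp k" unfolding h by (rule usp_similar) (simp_all add: QQ Q0)
  have sh: "star h = h" by (simp add: h_def star_mult sP sQ mult.assoc)
  have "pos (1 *\<^sub>R 1 - h)"
    unfolding pos_def
  proof (intro conjI ballI)
    show "star (1 *\<^sub>R 1 - h) = 1 *\<^sub>R 1 - h" using sh by (simp add: star_diff)
    fix t assume "t \<in> rsp (1 *\<^sub>R 1 - h)"
    then have "complex_of_real (1 - t) \<in> usp k" using sub by (subst (asm) rsp_diff) (auto simp: rsp_def)
    then show "0 \<le> t" using usp_norm[of "complex_of_real (1 - t)" k] nk by (simp only: norm_of_real) simp
  qed
  from pos_conj[OF this, of "Q (\<gamma> / 2)"] have "pos (Q (\<gamma> / 2) * (1 - h) * Q (\<gamma> / 2))" by (simp add: sQ)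
  also have "Q (\<gamma> / 2) * (1 - h) * Q (\<gamma> / 2) = Q \<gamma> - P \<gamma>"
    by (simp add: h_def algebra_simps QQ Q0)
  finally show ?thesis by (simp add: P_def Q_def \<gamma>_def)
qed

lemma Loewner_Heinz_aux:
  assumes "\<alpha> \<in> {0..1}"
  shows "pos (cf (pw d \<alpha>) b - cf (pw d \<alpha>) a)"
proof -
  note b = pos_lower_trans
  define E where "E = {\<alpha>. pos (cf (pw d \<alpha>) b - cf (pw d \<alpha>) a)}"
  have "closed E"
    unfolding closed_sequential_limits
  proof (intro allI impI, elim conjE)
    fix x l assume x: "\<forall>n. x n \<in> E" "x \<longlonglongrightarrow> l"
    have "pos (cf (pw d l) b - cf (pw d l) a)"
    proof (rule pos_LIMSEQ)
      show "(\<lambda>k. cf (pw d (x k)) b - cf (pw d (x k)) a) \<longlonglongrightarrow> cf (pw d l) b - cf (pw d l) a"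
        using x(2) by (intro tendsto_diff cf_pw_tendsto a b)
      show "pos (cf (pw d (x k)) b - cf (pw d (x k)) a)" for k using x(1) by (simp add: E_def)
    qed
    then show "l \<in> E" by (simp add: E_def)
  qed
  moreover have "0 \<in> E" "1 \<in> E"
    using ab by (auto simp: E_def cf_pw_0[OF a] cf_pw_0[OF b] cf_pw_1[OF a] cf_pw_1[OF b])
  moreover have "(x + y) / 2 \<in> E" if "x \<in> E" "y \<in> E" for x y
    using that Loewner_Heinz_midpoint by (simp add: E_def)
  ultimately have "\<alpha> \<in> E" using closed_midpoint_full assms by blast
  then show ?thesis by (simp add: E_def)
qed

text \<open>The contraction behind monotonicity, read from the other side:
  \<open>w * star w \<le> 1\<close> instead of \<open>star w * w \<le> 1\<close>, conjugated by the
  power of \<open>a\<close> instead of that of \<open>b\<close>.\<close>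

lemma pos_pw_antitone:
  assumes "\<alpha> \<in> {0..1}"
  shows "pos (cf (pw d (- \<alpha>)) a - cf (pw d (- \<alpha>)) b)"
proof -
  note b = pos_lower_trans
  define P where "P \<gamma> = cf (pw d \<gamma>) a" for \<gamma>
  define Q where "Q \<gamma> = cf (pw d \<gamma>) b" for \<gamma>
  have PP: "P x * P y = P (x + y)" "P x * (P y * z) = P (x + y) * z" for x y z
    using cf_pw_mult[OF a] by (simp_all add: P_def flip: mult.assoc)
  have QQ: "Q x * Q y = Q (x + y)" "Q x * (Q y * z) = Q (x + y) * z" for x y z
    using cf_pw_mult[OF b] by (simp_all add: Q_def flip: mult.assoc)
  have P0: "P 0 = 1" using cf_pw_0[OF a] by (simp add: P_def)
  have sP: "star (P x) = P x" and sQ: "star (Q x) = Q x" for x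
    using star_cf_pw[OF a] star_cf_pw[OF b] by (auto simp: P_def Q_def)
  define w where "w = P (\<alpha> / 2) * Q (- \<alpha> / 2)"
  have "norm w \<le> 1"
    unfolding w_def P_def Q_def by (intro norm_pw_quotient_le Loewner_Heinz_aux assms)
  then have "norm (w * star w) \<le> 1" by (simp add: cstar_identity' power_le_one)
  then have "pos (1 *\<^sub>R 1 - w * star w)" by (intro pos_norm_diff) (simp add: star_mult star_star)
  from pos_conj[OF this, of "P (- \<alpha> / 2)"]
  have "pos (P (- \<alpha> / 2) * (1 - w * star w) * P (- \<alpha> / 2))" by (simp add: sP)
  also have "P (- \<alpha> / 2) * (1 - w * star w) * P (- \<alpha> / 2) = P (- \<alpha>) - Q (- \<alpha>)"
    by (simp add: w_def algebra_simps PP P0 QQ star_mult sP sQ)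
  finally show ?thesis by (simp add: P_def Q_def)
qed

end

end

text \<open>Write the power of \<open>s + e\<close> as \<open>(s + e)\<close> times a decreasing
  power and estimate the parts for \<open>s\<close> and \<open>e\<close> separately. The bound is
  uniform in \<open>s\<close>, as convergence in the functional calculus demands.\<close>

lemma powr_add_diff_le:
  fixes s e \<gamma> :: real
  assumes "s \<ge> 0" "e > 0" "0 < \<gamma>" "\<gamma> \<le> 1"
  shows "\<bar>(s + e) powr \<gamma> - s powr \<gamma>\<bar> \<le> e powr \<gamma>"
proof -
  have split: "x powr \<gamma> = x * x powr (\<gamma> - 1)" if "x \<ge> 0" for x :: real
    using that powr_add[of x 1 "\<gamma> - 1"] by (cases "x = 0") auto
  have "s * (s + e) powr (\<gamma> - 1) \<le> s powr \<gamma>"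
  proof (cases "s = 0")
    case False
    then have "(s + e) powr (\<gamma> - 1) \<le> s powr (\<gamma> - 1)" using assms by (intro powr_mono2') auto
    then show ?thesis using assms by (simp add: split mult_left_mono)
  qed auto
  moreover have "e * (s + e) powr (\<gamma> - 1) \<le> e powr \<gamma>"
  proof -
    have "(s + e) powr (\<gamma> - 1) \<le> e powr (\<gamma> - 1)" using assms by (intro powr_mono2') auto
    then show ?thesis using assms by (simp add: split mult_left_mono)
  qed
  moreover have "(s + e) powr \<gamma> = s * (s + e) powr (\<gamma> - 1) + e * (s + e) powr (\<gamma> - 1)"
    using assms by (simp add: split[of "s + e"] distrib_right)
  moreover have "s powr \<gamma> \<le> (s + e) powr \<gamma>" using assms by (intro powr_mono2) auto
  ultimately show ?thesis by linarith
qed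

lemma continuous_on_max_powr:
  "\<gamma> > 0 \<Longrightarrow> continuous_on UNIV (\<lambda>t::real. max t 0 powr \<gamma>)"
  by (rule continuous_on_powr') (auto intro!: continuous_intros)

lemma cf_shift:
  assumes sa: "star a = (a::'a::cstar_algebra_1)" and f: "continuous_on UNIV f"
  shows "cf f (a + r *\<^sub>R 1) = cf (\<lambda>t. f (t + r)) a"
proof -
  have "a + r *\<^sub>R 1 = cf (\<lambda>t. t + r) a"
    by (simp add: cf_add[OF sa] cf_ident[OF sa] cf_const[OF sa] continuous_intros)
  then show ?thesis using cf_comp[OF sa _ f] by (simp add: continuous_intros)
qed

lemma LIMSEQ_inverse_powr:
  assumes "\<gamma> > 0"
  shows "(\<lambda>k. (1 / real (Suc k)) powr \<gamma>) \<longlonglongrightarrow> 0"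
proof -
  have "(\<lambda>k. 1 / real (Suc k)) \<longlonglongrightarrow> 0"
    using LIMSEQ_inverse_real_of_nat by (simp add: inverse_eq_divide)
  then have "(\<lambda>k. (1 / real (Suc k)) powr \<gamma>) \<longlonglongrightarrow> 0 powr \<gamma>"
    using assms by (intro tendsto_powr2) auto
  then show ?thesis using assms by simp
qed

lemma LIMSEQ_norm_le:
  assumes "\<And>k. norm (X k - L) \<le> r k" "r \<longlonglongrightarrow> 0"
  shows "X \<longlonglongrightarrow> L"
proof (rule LIM_zero_cancel)
  show "(\<lambda>k. X k - L) \<longlonglongrightarrow> 0"
    using assms(1) by (intro Lim_null_comparison[OF _ assms(2)] always_eventually) simp
qed

text \<open>Adding a small multiple of the unit to both elements provides the lower bound on the
  spectrum; as it tends to zero, the powers converge in norm and positivity of the difference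
  persists.\<close>

lemma Loewner_Heinz:
  fixes a b :: "'a::cstar_algebra_1"
  assumes a: "pos a" and ab: "pos (b - a)" and \<gamma>: "0 < \<gamma>" "\<gamma> \<le> 1"
  shows "pos (cf (\<lambda>t. max t 0 powr \<gamma>) b - cf (\<lambda>t. max t 0 powr \<gamma>) a)"
proof -
  have b: "pos b" using pos_add[OF a ab] by simp
  define e where "e k = 1 / real (Suc k)" for k
  have e: "e k > 0" for k by (simp add: e_def)
  have lim: "(\<lambda>k. cf (pw (e k) \<gamma>) (x + e k *\<^sub>R 1)) \<longlonglongrightarrow> cf (\<lambda>t. max t 0 powr \<gamma>) x" 
    if x: "pos x" for x :: 'a
  proof -
    note sx = pos_selfadjoint[OF x]
    have "norm (cf (pw (e k) \<gamma>) (x + e k *\<^sub>R 1) - cf (\<lambda>t. max t 0 powr \<gamma>) x) \<le> e k powr \<gamma>" for k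
      unfolding cf_shift[OF sx continuous_on_pw[OF e]]
    proof (rule norm_cf_diff_le[OF sx _ continuous_on_max_powr[OF \<gamma>(1)]])
      show "continuous_on UNIV (\<lambda>t. pw (e k) \<gamma> (t + e k))"
        unfolding pw_def using e[of k] by (intro continuous_intros) auto
      fix t assume "t \<in> rsp x"
      then have "t \<ge> 0" using x by (simp add: pos_def)
      then show "\<bar>pw (e k) \<gamma> (t + e k) - max t 0 powr \<gamma>\<bar> \<le> e k powr \<gamma>"
        using powr_add_diff_le[of t "e k" \<gamma>] e[of k] \<gamma> by (simp add: pw_def)
    qed
    moreover have "(\<lambda>k. e k powr \<gamma>) \<longlonglongrightarrow> 0" unfolding e_def by (rule LIMSEQ_inverse_powr[OF \<gamma>(1)])
    ultimately show ?thesis by (rule LIMSEQ_norm_le)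
  qed
  show ?thesis
  proof (rule pos_LIMSEQ[OF tendsto_diff[OF lim[OF b] lim[OF a]]])
    fix k
    show "pos (cf (pw (e k) \<gamma>) (b + e k *\<^sub>R 1) - cf (pw (e k) \<gamma>) (a + e k *\<^sub>R 1))"
      using a ab \<gamma> by (intro Loewner_Heinz_aux e) auto
  qed
qed

section \<open>Roots of sums of powers\<close>

lemma cf_power:
  assumes "star a = (a::'a::cstar_algebra_1)"
  shows "cf (\<lambda>t. t ^ n) a = a ^ n"
proof (induction n)
  case 0 then show ?case using cf_const[OF assms, of 1] by simp
next
  case (Suc n)
  then show ?case by (simp add: cf_mult[OF assms] cf_ident[OF assms] continuous_intros)
qed

lemma pos_power:
  assumes "pos a"
  shows "pos (a ^ n)"
proof -
  have "pos (cf (\<lambda>t. t ^ n) a)"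
    using assms by (intro pos_cf continuous_intros) (auto simp: pos_def)
  then show ?thesis using pos_selfadjoint[OF assms] by (simp add: cf_power)
qed

text \<open>For \<open>t \<ge> e\<close> the two terms agree; for \<open>t < e\<close> both lie
  between \<open>0\<close> and \<open>e powr r\<close>. Since \<open>r > 0\<close>, the error
  vanishes with \<open>e\<close>, uniformly in \<open>t\<close>.\<close>

lemma sqrt_pw_approx:
  fixes t e r q :: real
  assumes "t \<ge> 0" "e > 0" "q \<ge> 0" "r > 0" "r + q = 1/2"
  shows "\<bar>sqrt t * pw e (- q) t - t powr r\<bar> \<le> e powr r"
proof (cases "t \<ge> e")
  case True
  then have "sqrt t * pw e (- q) t = t powr (1/2 + - q)"
    using assms unfolding powr_add by (simp add: pw_def powr_half_sqrt)
  also have "1/2 + - q = r" using assms by simp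
  finally show ?thesis by simp
next
  case False
  then have "sqrt t * pw e (- q) t \<le> sqrt e * e powr (- q)"
    using assms by (simp add: pw_def mult_right_mono)
  also have "\<dots> = e powr (1/2 + - q)" 
    using assms unfolding powr_add by (simp add: powr_half_sqrt)
  also have "1/2 + - q = r" using assms by simp
  finally have "sqrt t * pw e (- q) t \<le> e powr r" .
  moreover have "sqrt t * pw e (- q) t \<ge> 0" using assms by (simp add: pw_def)
  moreover have "t powr r \<le> e powr r" "t powr r \<ge> 0" using False assms by (auto intro: powr_mono2)
  ultimately show ?thesis by linarith
qed

text \<open>Antitonicity will be applied to elements shifted by \<open>e\<close>, so values at
  \<open>t\<close> and at \<open>t + e\<close> must be compared. From
  \<open>max t e \<ge> (t + e) / 2\<close> the cost is \<open>2 powr p\<close>; this is the origin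
  of the factor \<open>2\<close>.\<close>

lemma pw_compare:
  fixes t e p :: real
  assumes "t \<ge> 0" "e > 0" "0 \<le> p" "p \<le> 1"
  shows "pw e (- p) t \<le> 2 * pw e (- p) (t + e)"
proof -
  have m: "max t e \<ge> (t + e) / 2" "(t + e) / 2 > 0" using assms by auto
  have "pw e (- p) t \<le> ((t + e) / 2) powr (- p)"
    unfolding pw_def using m assms by (intro powr_mono2') auto
  also have "\<dots> = 2 powr p * (t + e) powr (- p)"
    using assms by (simp add: powr_divide powr_minus divide_simps)
  also have "\<dots> \<le> 2 powr 1 * (t + e) powr (- p)"
    using assms by (intro mult_right_mono powr_mono) auto
  also have "\<dots> = 2 * pw e (- p) (t + e)" using assms by (simp add: pw_def)
  finally show ?thesis .
qed

definition half_power :: "'a::cstar_algebra_1 \<Rightarrow> nat \<Rightarrow> 'a"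
  where "half_power a n = cf (\<lambda>t. sqrt (max t 0 ^ n)) a"

context
  fixes a :: "'a::cstar_algebra_1" and n :: nat
  assumes a: "pos a"
begin

lemma half_power_cont: "continuous_on UNIV (\<lambda>t::real. sqrt (max t 0 ^ n))"
  by (intro continuous_intros)

lemma star_half_power: "star (half_power a n) = half_power a n"
  unfolding half_power_def by (rule star_cf[OF pos_selfadjoint[OF a] half_power_cont])

lemma half_power_sandwich:
  assumes "continuous_on UNIV f"
  shows "half_power a n * cf f a * half_power a n = cf (\<lambda>t. t ^ n * f t) a"
proof -
  note sa = pos_selfadjoint[OF a]
  have "half_power a n * cf f a * half_power a n
      = cf (\<lambda>t. sqrt (max t 0 ^ n) * f t * sqrt (max t 0 ^ n)) a"
    unfolding half_power_def using assms half_power_cont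
    by (simp add: cf_mult[OF sa] continuous_intros)
  also have "\<dots> = cf (\<lambda>t. t ^ n * f t) a"
  proof (rule cf_cong[OF sa])
    fix t assume "t \<in> rsp a"
    then have "t \<ge> 0" using a by (simp add: pos_def)
    then have "sqrt (max t 0 ^ n) * sqrt (max t 0 ^ n) = t ^ n" by simp
    then show "sqrt (max t 0 ^ n) * f t * sqrt (max t 0 ^ n) = t ^ n * f t"
      by (metis mult.assoc mult.commute)
  qed
  finally show ?thesis .
qed

lemma half_power_square: "half_power a n * half_power a n = a ^ n"
  using half_power_sandwich[of "\<lambda>t. 1"] cf_const[OF pos_selfadjoint[OF a], of 1]
    cf_power[OF pos_selfadjoint[OF a]] by simp

end

context
  fixes a c :: "'a::cstar_algebra_1" and n :: nat
  assumes a: "pos a" and ac: "pos (c - a ^ n)" and n: "n \<ge> 1"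
begin

lemma dominating_pos: "pos c"
  using pos_add[OF pos_power[OF a, of n] ac] by simp

text \<open>Since \<open>a ^ n \<le> c\<close>, the products \<open>half_power a n * cf (pw e (- q)) c\<close> are controlled by
  \<open>sqrt t * pw e (- q) t\<close> on the spectrum of \<open>c\<close>, which converges uniformly as \<open>e\<close> tends to \<open>0\<close>.\<close>

lemma half_power_pw_Cauchy:
  fixes e e' q r :: real
  assumes e: "e > 0" "e' > 0" and q: "q \<ge> 0" "r > 0" "r + q = 1/2"
  shows "norm (half_power a n * cf (pw e (- q)) c - half_power a n * cf (pw e' (- q)) c) \<le> e powr r + e' powr r"
proof -
  note sc = pos_selfadjoint[OF dominating_pos]
  note cont = continuous_on_pw[OF e(1), of "- q"] continuous_on_pw[OF e(2), of "- q"]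
  define g where "g t = pw e (- q) t - pw e' (- q) t" for t
  have cg: "continuous_on UNIV g" unfolding g_def using cont by (intro continuous_intros)
  have sg: "star (cf g c) = cf g c" by (rule star_cf[OF sc cg])
  let ?D = "half_power a n * cf g c"
  have D: "half_power a n * cf (pw e (- q)) c - half_power a n * cf (pw e' (- q)) c = ?D"
    unfolding g_def[abs_def] cf_diff[OF sc cont] by (simp add: algebra_simps)
  have "star ?D * ?D = cf g c * (half_power a n * half_power a n) * cf g c"
    by (simp add: star_mult sg star_half_power[OF a] mult.assoc)
  then have DD: "star ?D * ?D = star (cf g c) * a ^ n * cf g c" by (simp add: half_power_square[OF a] sg)
  \<comment> \<open>Passing to \<open>star ?D * ?D\<close> places \<open>a ^ n\<close> in the
    middle, where it may be replaced by the larger \<open>c\<close>; then everything is a function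
    of \<open>c\<close> alone.\<close>
  have "norm (star ?D * ?D) \<le> norm (star (cf g c) * c * cf g c)"
  proof (rule pos_mono_norm)
    show "pos (star (cf g c) * c * cf g c - star ?D * ?D)"
      unfolding DD by (rule pos_conj_diff[OF ac])
  qed (rule pos_star_mult)
  also have "star (cf g c) * c * cf g c = cf (\<lambda>t. g t * t * g t) c"
    using cg by (simp add: sg cf_mult[OF sc] cf_ident[OF sc] continuous_intros)
  also have "norm \<dots> \<le> (e powr r + e' powr r)\<^sup>2"
  proof (rule norm_cf_le[OF sc])
    show "continuous_on UNIV (\<lambda>t. g t * t * g t)" using cg by (intro continuous_intros)
    fix t assume "t \<in> rsp c"
    then have t: "t \<ge> 0" using dominating_pos by (simp add: pos_def)
    have "\<bar>sqrt t * g t\<bar> \<le> e powr r + e' powr r"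
      using sqrt_pw_approx[OF t e(1) q] sqrt_pw_approx[OF t e(2) q]
      unfolding g_def right_diff_distrib by linarith
    then have "\<bar>sqrt t * g t\<bar>\<^sup>2 \<le> (e powr r + e' powr r)\<^sup>2" by (intro power_mono) auto
    also have "\<bar>sqrt t * g t\<bar>\<^sup>2 = \<bar>g t * t * g t\<bar>"
      using t by (simp add: power2_eq_square abs_mult)
    finally show "\<bar>g t * t * g t\<bar> \<le> (e powr r + e' powr r)\<^sup>2" .
  qed
  finally have "(norm ?D)\<^sup>2 \<le> (e powr r + e' powr r)\<^sup>2" by (simp only: cstar_identity)
  then show ?thesis unfolding D by (rule power2_le_imp_le) simp
qed

text \<open>Antitonicity of \<open>t powr (- 2 q)\<close> replaces \<open>c\<close> by \<open>a ^ n\<close>.\<close>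

lemma half_power_pw_le:
  fixes e q :: real
  assumes e: "e > 0" and q: "q = (1 - 1 / real n) / 2"
  shows "pos (2 *\<^sub>R a - half_power a n * cf (pw e (- q)) c * star (half_power a n * cf (pw e (- q)) c))"
proof -
  note sa = pos_selfadjoint[OF a] and sc = pos_selfadjoint[OF dominating_pos]
  have q01: "2 * q \<in> {0..1}" "q \<ge> 0" using n by (auto simp: q field_simps)
  \<comment> \<open>\<open>cf F x\<close> is the truncated power of
    \<open>x + e *\<^sub>R 1\<close>, which for positive \<open>x\<close> is bounded below by
    \<open>e\<close>, as antitonicity requires.\<close>
  define F where "F t = pw e (- (2 * q)) (t + e)" for t
  have cF: "continuous_on UNIV F"
    unfolding F_def pw_def using e by (intro continuous_intros) auto
  have cp: "continuous_on UNIV (pw e \<alpha>)" for \<alpha> by (rule continuous_on_pw[OF e])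
  let ?s = "half_power a n"
  have "cf (pw e (- q)) c * cf (pw e (- q)) c = cf (pw e (- (2 * q))) c"
  proof -
    have "(\<lambda>t. pw e (- q) t * pw e (- q) t) = pw e (- (2 * q))"
      using pw_add[OF e, of "- q" "- q"] by (simp add: fun_eq_iff)
    then show ?thesis using cf_mult[OF sc cp cp, of "- q" "- q"] by simp
  qed
  then have Y: "?s * cf (pw e (- q)) c * star (?s * cf (pw e (- q)) c)
      = ?s * cf (pw e (- (2 * q))) c * ?s"
    by (simp add: star_mult star_half_power[OF a] star_cf[OF sc cp] flip: mult.assoc)
      (simp add: mult.assoc)
  have "pos (cf (\<lambda>t. 2 * F t) c - cf (pw e (- (2 * q))) c)"
  proof (rule pos_cf_diff[OF sc cp])
    show "continuous_on UNIV (\<lambda>t. 2 * F t)" using cF by (intro continuous_intros)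
    fix t assume "t \<in> rsp c"
    then have "t \<ge> 0" using dominating_pos by (simp add: pos_def)
    then show "pw e (- (2 * q)) t \<le> 2 * F t" unfolding F_def using q01 e by (intro pw_compare) auto
  qed
  then have 1: "pos (2 *\<^sub>R cf F c - cf (pw e (- (2 * q))) c)" by (simp add: cf_scaleR[OF sc cF])
  have "pos (cf (pw e (- (2 * q))) (a ^ n + e *\<^sub>R 1) - cf (pw e (- (2 * q))) (c + e *\<^sub>R 1))"
    using ac pos_power[OF a] by (intro pos_pw_antitone[OF e _ _ q01(1)]) auto
  then have 2: "pos (cf F (a ^ n) - cf F c)"
    unfolding cf_shift[OF sc cp] cf_shift[OF pos_selfadjoint[OF pos_power[OF a]] cp] F_def[symmetric] .
  have 3: "cf F (a ^ n) = cf (\<lambda>t. F (t ^ n)) a"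
    using cf_comp[OF sa _ cF, of "\<lambda>t. t ^ n"] by (simp add: cf_power[OF sa] continuous_intros)
  have cFn: "continuous_on UNIV (\<lambda>t. F (t ^ n))"
    using continuous_on_compose[OF _ continuous_on_subset[OF cF], of UNIV "\<lambda>t. t ^ n"]
    by (simp add: o_def continuous_intros)
  have "pos (cf (\<lambda>t. t) a - cf (\<lambda>t. t ^ n * F (t ^ n)) a)"
  proof (rule pos_cf_diff[OF sa])
    show "continuous_on UNIV (\<lambda>t. t ^ n * F (t ^ n))" using cFn by (intro continuous_intros)
    fix t assume "t \<in> rsp a"
    then have t: "t \<ge> 0" using a by (simp add: pos_def)
    show "t ^ n * F (t ^ n) \<le> t"
    proof (cases "t = 0")
      case True then show ?thesis using n by (simp add: zero_power)
    next
      case False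
      then have tn: "t ^ n > 0" using t by simp
      have "F (t ^ n) \<le> (t ^ n) powr (- (2 * q))"
        unfolding F_def pw_def using tn e q01 by (intro powr_mono2') auto
      then have "t ^ n * F (t ^ n) \<le> (t ^ n) powr 1 * (t ^ n) powr (- (2 * q))"
        using tn by (simp add: mult_left_mono)
      also have "\<dots> = (t ^ n) powr (1 + - (2 * q))" by (simp only: powr_add)
      \<comment> \<open>The value of \<open>q\<close> makes the remaining power of
        \<open>t ^ n\<close> collapse to \<open>t\<close>.\<close>
      also have "1 + - (2 * q) = 1 / real n" using n by (simp add: q field_simps)
      also have "(t ^ n) powr (1 / real n) = t" using False t n by (simp add: powr_powr flip: powr_realpow)
      finally show ?thesis .
    qed
  qed (intro continuous_intros)
  then have 4: "pos (a - ?s * cf F (a ^ n) * ?s)"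
    unfolding 3 half_power_sandwich[OF a cFn] cf_ident[OF sa] .
  \<comment> \<open>A telescoping sum from \<open>2 *\<^sub>R a\<close> down to the product: twice
    gap \<open>4\<close>, twice the conjugate of gap \<open>2\<close>, then the conjugate of gap
    \<open>1\<close>.\<close>
  have "pos ((2 *\<^sub>R (a - ?s * cf F (a ^ n) * ?s)
      + 2 *\<^sub>R (star ?s * cf F (a ^ n) * ?s - star ?s * cf F c * ?s))
      + (star ?s * (2 *\<^sub>R cf F c) * ?s - star ?s * cf (pw e (- (2 * q))) c * ?s))"
    by (rule pos_add[OF pos_add[OF pos_scaleR[OF 4] pos_scaleR[OF pos_conj_diff[OF 2]]] pos_conj_diff[OF 1]])
      auto
  then show ?thesis unfolding Y by (simp add: star_half_power[OF a] algebra_simps)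
qed

end

text \<open>Because \<open>1 - 2 * q = 1 / n\<close>, the function on the left is
  \<open>t powr (1 / n)\<close> wherever \<open>t \<ge> e\<close>. Below \<open>e\<close> both
  functions are at most \<open>e powr (1 / n)\<close>.\<close>

lemma cf_pw_sandwich_tendsto:
  fixes c :: "'a::cstar_algebra_1"
  assumes c: "pos c" and n: "n \<ge> 1" and q: "q = (1 - 1 / real n) / 2"
  shows "(\<lambda>k. cf (pw (1 / real (Suc k)) (- q)) c * c * cf (pw (1 / real (Suc k)) (- q)) c)
    \<longlonglongrightarrow> cf (\<lambda>t. max t 0 powr (1 / real n)) c"
proof -
  note sc = pos_selfadjoint[OF c]
  define \<gamma> where "\<gamma> = 1 / real n"
  have \<gamma>: "\<gamma> > 0" using n by (simp add: \<gamma>_def)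
  have "norm (cf (pw e (- q)) c * c * cf (pw e (- q)) c - cf (\<lambda>t. max t 0 powr \<gamma>) c) \<le> e powr \<gamma>"
    if e: "e > 0" for e
  proof -
    have cp: "continuous_on UNIV (pw e (- q))" by (rule continuous_on_pw[OF e])
    then have cpp: "continuous_on UNIV (\<lambda>t. pw e (- q) t * t * pw e (- q) t)" by (intro continuous_intros)
    have eq: "cf (pw e (- q)) c * c * cf (pw e (- q)) c = cf (\<lambda>t. pw e (- q) t * t * pw e (- q) t) c"
      using cp by (simp add: cf_mult[OF sc] cf_ident[OF sc] continuous_intros)
    show ?thesis unfolding eq
    proof (rule norm_cf_diff_le[OF sc cpp continuous_on_max_powr[OF \<gamma>]])
      fix t assume "t \<in> rsp c"
      then have t: "t \<ge> 0" using c by (simp add: pos_def)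
      have ppw: "pw e (- q) t * t * pw e (- q) t = t * max t e powr (\<gamma> - 1)"
      proof -
        have "pw e (- q) t * pw e (- q) t = max t e powr (- q + - q)"
          unfolding powr_add pw_def ..
        also have "- q + - q = \<gamma> - 1" by (simp add: q \<gamma>_def field_simps)
        finally show ?thesis by (simp add: mult_ac)
      qed
      have split: "x powr \<gamma> = x * x powr (\<gamma> - 1)" if "x > 0" for x :: real
        using that powr_add[of x 1 "\<gamma> - 1"] by simp
      show "\<bar>pw e (- q) t * t * pw e (- q) t - max t 0 powr \<gamma>\<bar> \<le> e powr \<gamma>"
      proof (cases "t \<ge> e")
        case True
        then show ?thesis using e by (simp add: ppw split)
      next
        case False
        then have "t * max t e powr (\<gamma> - 1) \<le> e powr \<gamma>"
          using e by (simp add: split[of e] mult_right_mono)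
        moreover have "t powr \<gamma> \<le> e powr \<gamma>" using False t \<gamma> by (intro powr_mono2) auto
        moreover have "t * max t e powr (\<gamma> - 1) \<ge> 0" "t powr \<gamma> \<ge> 0" using t by auto
        ultimately show ?thesis unfolding ppw max_absorb1[OF t] by linarith
      qed
    qed
  qed
  then show ?thesis unfolding \<gamma>_def
    by (rule LIMSEQ_norm_le[OF _ LIMSEQ_inverse_powr]) (use n in auto)
qed

lemma root_factor:
  fixes a c :: "'a::cstar_algebra_1"
  assumes a: "pos a" and ac: "pos (c - a ^ n)" and n: "n \<ge> 1" and q: "q = (1 - 1 / real n) / 2"
  obtains y where "(\<lambda>k. half_power a n * cf (pw (1 / real (Suc k)) (- q)) c) \<longlonglongrightarrow> y"
    "pos (y * star y)" "pos (2 *\<^sub>R a - y * star y)"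
proof -
  \<comment> \<open>What is left of the exponent \<open>1/2\<close> of \<open>sqrt t\<close> after
    subtracting \<open>q\<close>; it is positive, so the Cauchy estimate tends to zero.\<close>
  define r where "r = 1 / (2 * real n)"
  have qr: "q \<ge> 0" "r > 0" "r + q = 1/2" using n by (auto simp: q r_def field_simps)
  define e where "e k = 1 / real (Suc k)" for k
  have e: "e k > 0" for k by (simp add: e_def)
  define Y where "Y k = half_power a n * cf (pw (e k) (- q)) c" for k
  have "Cauchy Y"
  proof (rule metric_CauchyI)
    fix d :: real assume d: "d > 0"
    have "(\<lambda>k. e k powr r) \<longlonglongrightarrow> 0" unfolding e_def by (rule LIMSEQ_inverse_powr[OF qr(2)])
    then have "\<forall>\<^sub>F k in sequentially. e k powr r < d / 2" using d by (intro order_tendstoD) auto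
    then obtain K where K: "\<And>k. k \<ge> K \<Longrightarrow> e k powr r < d / 2" by (auto simp: eventually_sequentially)
    have "dist (Y k) (Y l) < d" if "k \<ge> K" "l \<ge> K" for k l
      using half_power_pw_Cauchy[OF a ac n e e qr, of k l] K[OF that(1)] K[OF that(2)]
      unfolding dist_norm Y_def by linarith
    then show "\<exists>M. \<forall>m\<ge>M. \<forall>n\<ge>M. dist (Y m) (Y n) < d" by blast
  qed
  then obtain y where y: "Y \<longlonglongrightarrow> y" using Cauchy_convergent unfolding convergent_def by blast
  have "(\<lambda>k. 2 *\<^sub>R a - Y k * star (Y k)) \<longlonglongrightarrow> 2 *\<^sub>R a - y * star y"
    using y by (intro tendsto_intros tendsto_star)
  then have "pos (2 *\<^sub>R a - y * star y)"
    by (rule pos_LIMSEQ) (use half_power_pw_le[OF a ac n e q] in \<open>simp add: Y_def\<close>)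
  moreover have "pos (y * star y)" using pos_star_mult[of "star y"] by (simp add: star_star)
  ultimately show ?thesis using that y unfolding Y_def e_def by blast
qed

text \<open>All factors share the same \<open>P k\<close>, so for each \<open>k\<close> the sum of
  the \<open>star Y * Y\<close> is exactly \<open>P k * c * P k\<close>; the limits of both sides
  are then compared.\<close>

lemma root_sum_powers:
  fixes a :: "'i \<Rightarrow> 'a::cstar_algebra_1"
  assumes S: "finite S" and a: "\<And>i. i \<in> S \<Longrightarrow> pos (a i)" and n: "n \<ge> 1"
    and c: "c = (\<Sum>i\<in>S. a i ^ n)" and q: "q = (1 - 1 / real n) / 2"
  obtains y where
    "\<And>i. i \<in> S \<Longrightarrow> (\<lambda>k. half_power (a i) n * cf (pw (1 / real (Suc k)) (- q)) c) \<longlonglongrightarrow> y i"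
    "\<And>i. i \<in> S \<Longrightarrow> pos (y i * star (y i))"
    "\<And>i. i \<in> S \<Longrightarrow> pos (2 *\<^sub>R a i - y i * star (y i))"
    "cf (\<lambda>t. max t 0 powr (1 / real n)) c = (\<Sum>i\<in>S. star (y i) * y i)"
proof -
  have pc: "pos c" unfolding c using a by (intro pos_sum pos_power) auto
  have dom: "pos (c - a i ^ n)" if "i \<in> S" for i
  proof -
    have "c - a i ^ n = (\<Sum>j\<in>S - {i}. a j ^ n)" using S that by (simp add: c sum_diff1)
    then show ?thesis using a by (auto intro!: pos_sum pos_power)
  qed
  define P where "P k = cf (pw (1 / real (Suc k)) (- q)) c" for k
  have "\<exists>y. (\<lambda>k. half_power (a i) n * P k) \<longlonglongrightarrow> y \<and>
      pos (y * star y) \<and> pos (2 *\<^sub>R a i - y * star y)" if "i \<in> S" for i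
    unfolding P_def using root_factor[OF a dom n q] that by metis
  then obtain y where y: "\<And>i. i \<in> S \<Longrightarrow> (\<lambda>k. half_power (a i) n * P k) \<longlonglongrightarrow> y i"
      "\<And>i. i \<in> S \<Longrightarrow> pos (y i * star (y i))"
      "\<And>i. i \<in> S \<Longrightarrow> pos (2 *\<^sub>R a i - y i * star (y i))"
    by metis
  have sP: "star (P k) = P k" for k
    unfolding P_def by (intro star_cf continuous_on_pw pos_selfadjoint pc) simp
  have "(\<lambda>k. \<Sum>i\<in>S. star (half_power (a i) n * P k) * (half_power (a i) n * P k))
      \<longlonglongrightarrow> (\<Sum>i\<in>S. star (y i) * y i)"
    by (intro tendsto_intros tendsto_star y)
  also have "(\<lambda>k. \<Sum>i\<in>S. star (half_power (a i) n * P k) * (half_power (a i) n * P k)) = (\<lambda>k. P k * c * P k)"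
  proof
    fix k
    have "star (half_power (a i) n * P k) * (half_power (a i) n * P k) = P k * a i ^ n * P k"
      if i: "i \<in> S" for i
      using half_power_square[OF a[OF i]]
      by (simp add: star_mult sP star_half_power[OF a[OF i]] mult.assoc
          flip: mult.assoc[of "half_power (a i) n"])
    then show "(\<Sum>i\<in>S. star (half_power (a i) n * P k) * (half_power (a i) n * P k)) = P k * c * P k"
      by (simp add: c sum_distrib_left sum_distrib_right)
  qed
  finally have "cf (\<lambda>t. max t 0 powr (1 / real n)) c = (\<Sum>i\<in>S. star (y i) * y i)"
    using cf_pw_sandwich_tendsto[OF pc n q] LIMSEQ_unique unfolding P_def by blast
  with y show ?thesis using that unfolding P_def by blast
qed

section \<open>Unitization\<close>

text \<open>A type of its own, as pairs already carry the product norm, which is not a C*-norm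
  here.\<close>

datatype 'a unitization = Unitization (alg: 'a) (scal: complex)

lemma unitization_eq_iff: "x = y \<longleftrightarrow> alg x = alg y \<and> scal x = scal y"
  by (cases x; cases y) auto

instantiation unitization :: (cstar_algebra) real_algebra_1
begin

definition "0 = Unitization 0 0"
definition "1 = Unitization 0 1"
definition "x + y = Unitization (alg x + alg y) (scal x + scal y)"
definition "x - y = Unitization (alg x - alg y) (scal x - scal y)"
definition "- x = Unitization (- alg x) (- scal x)"
definition "x * y = Unitization (alg x * alg y + scal x *\<^sub>C alg y + scal y *\<^sub>C alg x) (scal x * scal y)"
definition "r *\<^sub>R x = Unitization (r *\<^sub>R alg x) (complex_of_real r * scal x)"

lemmas unitization_ops_defs = zero_unitization_def one_unitization_def plus_unitization_def
  minus_unitization_def uminus_unitization_def times_unitization_def scaleR_unitization_def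

instance
  by standard
    (simp_all add: unitization_ops_defs unitization_eq_iff algebra_simps mult_scaleC_left mult_scaleC_right
      scaleC_scaleC scaleC_add_right scaleC_add_left flip: scaleC_of_real)

end

lemma unitization_sel [simp]:
  fixes x y :: "'a::cstar_algebra unitization"
  shows "alg 0 = (0::'a)" "scal (0 :: 'a unitization) = 0" "alg 1 = (0::'a)" "scal (1 :: 'a unitization) = 1"
    "alg (x + y) = alg x + alg y" "scal (x + y) = scal x + scal y"
    "alg (x - y) = alg x - alg y" "scal (x - y) = scal x - scal y"
    "alg (- x) = - alg x" "scal (- x) = - scal x"
    "alg (x * y) = alg x * alg y + scal x *\<^sub>C alg y + scal y *\<^sub>C alg x" "scal (x * y) = scal x * scal y"
    "alg (r *\<^sub>R x) = r *\<^sub>R alg x" "scal (r *\<^sub>R x) = complex_of_real r * scal x"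
  by (simp_all add: unitization_ops_defs)

definition lact :: "'a::cstar_algebra unitization \<Rightarrow> 'a \<Rightarrow> 'a"
  where "lact x y = alg x * y + scal x *\<^sub>C y"

lemma bounded_linear_lact: "bounded_linear (lact x)"
  unfolding lact_def
  by (intro bounded_linear_add bounded_linear_mult_right bounded_linear_scaleC)

lemma norm_lact_le: "norm (lact x y) \<le> onorm (lact x) * norm y"
  by (rule onorm[OF bounded_linear_lact])

lemma lact_add: "lact (x + y) = (\<lambda>z. lact x z + lact y z)"
  by (auto simp: lact_def algebra_simps scaleC_add_left)

lemma lact_scaleR: "lact (r *\<^sub>R x) = (\<lambda>z. r *\<^sub>R lact x z)"
  by (rule ext) (simp add: lact_def scaleC_add_right scaleC_scaleC mult_scaleC_left flip: scaleC_of_real)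

lemma lact_mult: "lact (x * y) = lact x \<circ> lact y"
  by (auto simp: lact_def algebra_simps scaleC_add_right scaleC_scaleC mult_scaleC_left mult_scaleC_right)

lemma lact_one: "lact 1 = (\<lambda>z. z)"
  by (auto simp: lact_def)

text \<open>Left multiplication alone only gives a seminorm if \<open>'a\<close> has a unit. The maximum with the
  quotient seminorm \<open>cmod (scal x)\<close> is a C*-norm in every case.\<close>

instantiation unitization :: (cstar_algebra) real_normed_algebra_1
begin

definition "norm (x :: 'a unitization) = max (onorm (lact x)) (cmod (scal x))"
definition "dist x y = norm (x - y :: 'a unitization)"
definition "sgn x = x /\<^sub>R norm (x :: 'a unitization)"
definition uniformity_unitization_def: "(uniformity :: ('a unitization \<times> 'a unitization) filter)
  = (INF e\<in>{0<..}. principal {(x, y). dist x y < e})"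
definition open_unitization_def: "open (U :: 'a unitization set)
  \<longleftrightarrow> (\<forall>x\<in>U. eventually (\<lambda>(x', y). x' = x \<longrightarrow> y \<in> U) uniformity)"

instance
proof
  fix x y :: "'a unitization" and r :: real
  have nn: "onorm (lact z) \<ge> 0" for z :: "'a unitization" by (rule onorm_pos_le[OF bounded_linear_lact])
  show "norm x = 0 \<longleftrightarrow> x = 0"
  proof
    assume "norm x = 0"
    then have 0: "onorm (lact x) = 0" "scal x = 0"
      using nn[of x] norm_ge_zero[of "scal x"] unfolding norm_unitization_def by (auto simp: max_def split: if_splits)
    \<comment> \<open>With vanishing scalar part, testing the action on \<open>star (alg x)\<close>
      brings in the C*-identity.\<close>
    then have "norm (lact x (star (alg x))) \<le> 0" using norm_lact_le[of x "star (alg x)"] by simp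
    then have "alg x * star (alg x) = 0" using 0 by (simp add: lact_def)
    then have "alg x = 0" using cstar_identity'[of "alg x"] by simp
    with 0 show "x = 0" by (simp add: unitization_eq_iff)
  next
    assume "x = 0"
    moreover have "lact (0 :: 'a unitization) = (\<lambda>z. 0)" by (auto simp: lact_def)
    ultimately show "norm x = 0" by (simp add: norm_unitization_def onorm_zero)
  qed
  have "onorm (lact (x + y)) \<le> onorm (lact x) + onorm (lact y)"
    unfolding lact_add by (rule onorm_triangle[OF bounded_linear_lact bounded_linear_lact])
  then show "norm (x + y) \<le> norm x + norm y"
    using norm_triangle_ineq[of "scal x" "scal y"] unfolding norm_unitization_def by auto
  have "onorm (lact (r *\<^sub>R x)) = \<bar>r\<bar> * onorm (lact x)"
    unfolding lact_scaleR by (rule onorm_scaleR[OF bounded_linear_lact])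
  then show "norm (r *\<^sub>R x) = \<bar>r\<bar> * norm x"
    by (simp add: norm_unitization_def norm_mult max_mult_distrib_left)
  have "onorm (lact (x * y)) \<le> onorm (lact x) * onorm (lact y)"
    unfolding lact_mult by (rule onorm_compose[OF bounded_linear_lact bounded_linear_lact])
  also have "\<dots> \<le> norm x * norm y"
    unfolding norm_unitization_def using nn by (intro mult_mono) (auto simp: le_max_iff_disj)
  finally have "onorm (lact (x * y)) \<le> norm x * norm y" .
  moreover have "cmod (scal (x * y)) \<le> norm x * norm y"
    unfolding norm_unitization_def unitization_sel norm_mult using nn
    by (intro mult_mono) (auto simp: le_max_iff_disj)
  ultimately show "norm (x * y) \<le> norm x * norm y" unfolding norm_unitization_def[of "x * y"] by simp
  have "onorm (lact (1 :: 'a unitization)) \<le> 1"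
    unfolding lact_one by (rule onorm_id_le)
  then show "norm (1 :: 'a unitization) = 1" by (simp add: norm_unitization_def max_def)
qed (rule dist_unitization_def sgn_unitization_def uniformity_unitization_def open_unitization_def)+

end

definition incl :: "'a::cstar_algebra \<Rightarrow> 'a unitization"
  where "incl a = Unitization a 0"

lemma incl_sel [simp]: "alg (incl a) = a" "scal (incl a) = 0"
  by (simp_all add: incl_def)

lemma incl_inject [simp]: "incl a = incl b \<longleftrightarrow> a = b"
  by (simp add: incl_def)

lemma incl_alg: "scal x = 0 \<Longrightarrow> incl (alg x) = x"
  by (simp add: unitization_eq_iff)

lemma incl_hom:
  "incl 0 = 0" "incl (a + b) = incl a + incl b" "incl (a - b) = incl a - incl b"
  "incl (a * b) = incl a * incl b" "incl (r *\<^sub>R a) = r *\<^sub>R incl a"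
  by (simp_all add: unitization_eq_iff)

lemma incl_sum: "incl (sum f S) = (\<Sum>i\<in>S. incl (f i))"
  by (induction S rule: infinite_finite_induct) (auto simp: incl_hom)

text \<open>By the C*-identity, left multiplication by \<open>a\<close> attains the factor
  \<open>norm a\<close> on \<open>star a\<close>.\<close>

lemma norm_incl [simp]: "norm (incl a) = norm (a::'a::cstar_algebra)"
proof -
  have l: "lact (incl a) = (\<lambda>y. a * y)" by (auto simp: lact_def)
  have le: "onorm (lact (incl a)) \<le> norm a"
    unfolding l by (rule onorm_bound) (auto simp: norm_mult_ineq)
  have "norm a \<le> onorm (lact (incl a))"
  proof (cases "a = 0")
    case False
    have "norm a * norm a \<le> onorm (lact (incl a)) * norm a"
      using norm_lact_le[of "incl a" "star a"] unfolding l by (simp add: cstar_identity' power2_eq_square)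
    with False show ?thesis by simp
  qed (simp add: onorm_pos_le[OF bounded_linear_lact])
  with le show ?thesis by (simp add: norm_unitization_def)
qed

lemma cmod_scal_le: "cmod (scal x) \<le> norm (x :: 'a::cstar_algebra unitization)"
  by (simp add: norm_unitization_def)

lemma tendsto_scal:
  assumes "X \<longlonglongrightarrow> (x :: 'a::cstar_algebra unitization)"
  shows "(\<lambda>k. scal (X k)) \<longlonglongrightarrow> scal x"
proof -
  have "bounded_linear (scal :: 'a unitization \<Rightarrow> complex)"
    by (rule bounded_linear_intro[where K=1]) (auto simp: cmod_scal_le scaleR_conv_of_real[where 'a=complex])
  then show ?thesis using assms by (rule bounded_linear.tendsto)
qed

lemma incl_tendsto_iff: "(\<lambda>k. incl (X k)) \<longlonglongrightarrow> incl a \<longleftrightarrow> X \<longlonglongrightarrow> (a :: 'a::cstar_algebra)"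
  by (simp add: tendsto_iff dist_norm flip: incl_hom)

instantiation unitization :: (cstar_algebra) cstar_algebra_1
begin

definition "c *\<^sub>C x = Unitization (c *\<^sub>C alg x) (c * scal x)"
definition "star x = Unitization (star (alg x)) (cnj (scal x))"

lemma unitization_star_sel [simp]:
  fixes x :: "'a unitization"
  shows "alg (c *\<^sub>C x) = c *\<^sub>C alg x" "scal (c *\<^sub>C x) = c * scal x"
    "alg (star x) = star (alg x)" "scal (star x) = cnj (scal x)"
  by (simp_all add: scaleC_unitization_def star_unitization_def)

text \<open>The argument for operators on a Hilbert space, with the C*-identity of \<open>'a\<close>
  in place of the inner product: \<open>star x\<close> can be moved across in
  \<open>star (lact x y) * lact x y\<close>.\<close>

lemma onorm_lact_square: "(onorm (lact x))\<^sup>2 \<le> onorm (lact (star x * x))" for x :: "'a unitization"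
proof -
  have "norm (lact x y) \<le> sqrt (onorm (lact (star x * x))) * norm y" for y
  proof -
    have "star (lact x y) * lact x y = star y * lact (star x) (lact x y)"
      by (simp add: lact_def star_add star_mult star_scaleC algebra_simps mult_scaleC_left mult_scaleC_right)
    then have "(norm (lact x y))\<^sup>2 = norm (star y * lact (star x * x) y)"
      by (simp add: lact_mult flip: cstar_identity)
    also have "\<dots> \<le> norm y * (onorm (lact (star x * x)) * norm y)"
      using norm_mult_ineq[of "star y"] mult_left_mono[OF norm_lact_le[of "star x * x" y] norm_ge_zero[of y]]
      by (metis norm_star order_trans)
    also have "\<dots> = (sqrt (onorm (lact (star x * x))) * norm y)\<^sup>2"
      using real_sqrt_pow2[OF onorm_pos_le[OF bounded_linear_lact, of "star x * x"]]
      by (simp only: power_mult_distrib) (simp add: power2_eq_square)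
    finally show ?thesis
      by (rule power2_le_imp_le) (simp add: onorm_pos_le[OF bounded_linear_lact])
  qed
  then have "onorm (lact x) \<le> sqrt (onorm (lact (star x * x)))" 
    by (intro onorm_bound) (auto simp: onorm_pos_le[OF bounded_linear_lact])
  then show ?thesis
    using onorm_pos_le[OF bounded_linear_lact] by (metis real_sqrt_le_iff real_sqrt_abs abs_of_nonneg)
qed

instance
proof
  fix c d :: complex and r :: real and x y :: "'a unitization"
  show "c *\<^sub>C (x + y) = c *\<^sub>C x + c *\<^sub>C y" "(c + d) *\<^sub>C x = c *\<^sub>C x + d *\<^sub>C x"
    "c *\<^sub>C (d *\<^sub>C x) = (c * d) *\<^sub>C x" "complex_of_real r *\<^sub>C x = r *\<^sub>R x"
    "(c *\<^sub>C x) * y = c *\<^sub>C (x * y)" "x * (c *\<^sub>C y) = c *\<^sub>C (x * y)"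
    "star (x + y) = star x + star y" "star (c *\<^sub>C x) = cnj c *\<^sub>C star x"
    "star (x * y) = star y * star x" "star (star x) = x"
    by (simp_all add: unitization_eq_iff algebra_simps mult_scaleC_left mult_scaleC_right scaleC_scaleC
        scaleC_add_right scaleC_add_left star_add star_mult star_scaleC star_star flip: scaleC_of_real)
  have le: "norm (c *\<^sub>C x) \<le> cmod c * norm x" for c and x :: "'a unitization"
  proof -
    have "onorm (lact (c *\<^sub>C x)) \<le> cmod c * onorm (lact x)"
    proof (rule onorm_bound)
      show "0 \<le> cmod c * onorm (lact x)" by (simp add: onorm_pos_le[OF bounded_linear_lact])
      fix z
      have "lact (c *\<^sub>C x) z = c *\<^sub>C lact x z"
        by (simp add: lact_def mult_scaleC_left scaleC_scaleC scaleC_add_right)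
      then show "norm (lact (c *\<^sub>C x) z) \<le> cmod c * onorm (lact x) * norm z"
        using mult_left_mono[OF norm_lact_le[of x z] norm_ge_zero[of c]] by (simp add: norm_scaleC mult_ac)
    qed
    then show ?thesis by (simp add: norm_unitization_def norm_mult max_mult_distrib_left)
  qed
  show "norm (c *\<^sub>C x) = cmod c * norm x"
  proof (cases "c = 0")
    case True
    have "(0::complex) *\<^sub>C x = 0" by (simp add: unitization_eq_iff)
    then show ?thesis using True by simp
  next
    case False
    have "inverse c *\<^sub>C (c *\<^sub>C x) = x" using False by (simp add: unitization_eq_iff scaleC_scaleC)
    then have "norm x \<le> inverse (cmod c) * norm (c *\<^sub>C x)" using le[of "inverse c" "c *\<^sub>C x"] by (simp add: norm_inverse)
    with False have "cmod c * norm x \<le> norm (c *\<^sub>C x)" by (simp add: field_simps)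
    with le[of c x] show ?thesis by simp
  qed
  have pn: "onorm (lact x) \<ge> 0" for x :: "'a unitization" by (rule onorm_pos_le[OF bounded_linear_lact])
  have prod: "onorm (lact (star x * x)) \<le> onorm (lact (star x)) * onorm (lact x)" for x :: "'a unitization"
    unfolding lact_mult by (rule onorm_compose[OF bounded_linear_lact bounded_linear_lact])
  have pstar: "onorm (lact x) \<le> onorm (lact (star x))" for x :: "'a unitization"
  proof (cases "onorm (lact x) = 0")
    case False
    have "onorm (lact x) * onorm (lact x) \<le> onorm (lact (star x)) * onorm (lact x)"
      using onorm_lact_square[of x] prod[of x] by (simp add: power2_eq_square)
    then show ?thesis using False pn[of x] by simp
  qed (use pn in simp)
  have ss: "star (star x) = x" by (simp add: unitization_eq_iff star_star)
  have "onorm (lact (star x)) = onorm (lact x)" using pstar[of x] pstar[of "star x"] ss by simp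
  then have "onorm (lact (star x * x)) = (onorm (lact x))\<^sup>2"
    using onorm_lact_square[of x] prod[of x] by (simp add: power2_eq_square)
  moreover have "cmod (scal (star x * x)) = (cmod (scal x))\<^sup>2" by (simp add: norm_mult power2_eq_square)
  moreover have "max (u\<^sup>2) (v\<^sup>2) = (max u v)\<^sup>2" if "u \<ge> 0" "v \<ge> 0" for u v :: real
    using that by (auto simp: max_def power_mono dest: power2_le_imp_le)
  ultimately show "norm (star x * x) = (norm x)\<^sup>2" by (simp add: norm_unitization_def pn)
next
  fix X :: "nat \<Rightarrow> 'a unitization"
  assume X: "Cauchy X"
  \<comment> \<open>Completeness: scalar parts converge because \<open>scal\<close> is contractive;
    after subtracting them the sequence lies in the image of the isometry \<open>incl\<close> of a
    complete space.\<close>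
  have "Cauchy (\<lambda>k. scal (X k))"
  proof (rule metric_CauchyI)
    fix e :: real assume "e > 0"
    then obtain M where M: "\<And>m n. m \<ge> M \<Longrightarrow> n \<ge> M \<Longrightarrow> dist (X m) (X n) < e"
      using metric_CauchyD[OF X] by blast
    have "dist (scal (X m)) (scal (X n)) \<le> dist (X m) (X n)" for m n
      using cmod_scal_le[of "X m - X n"] by (simp add: dist_norm)
    then show "\<exists>M. \<forall>m\<ge>M. \<forall>n\<ge>M. dist (scal (X m)) (scal (X n)) < e"
      using M by (meson le_less_trans)
  qed
  then obtain c where c: "(\<lambda>k. scal (X k)) \<longlonglongrightarrow> c" using Cauchy_convergent unfolding convergent_def by blast
  have nU: "norm (Unitization (0::'a) z) = cmod z" for z
  proof -
    have "lact (Unitization (0::'a) z) = (\<lambda>y. z *\<^sub>C y)" by (auto simp: lact_def)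
    then have "onorm (lact (Unitization (0::'a) z)) \<le> cmod z"
      by (auto intro: onorm_bound simp: norm_scaleC)
    then show ?thesis by (simp add: norm_unitization_def)
  qed
  define U where "U k = Unitization (0::'a) (scal (X k))" for k
  have U: "U \<longlonglongrightarrow> Unitization 0 c"
  proof -
    have "U k - Unitization 0 c = Unitization 0 (scal (X k) - c)" for k
      by (simp add: U_def unitization_eq_iff)
    then show ?thesis using c unfolding tendsto_iff dist_norm nU by (simp add: nU)
  qed
  have XU: "X k - U k = incl (alg (X k))" for k by (simp add: U_def unitization_eq_iff)
  have "Cauchy (\<lambda>k. X k - U k)"
  proof (rule metric_CauchyI)
    fix e :: real assume e: "e > 0"
    obtain M where M: "\<And>m n. m \<ge> M \<Longrightarrow> n \<ge> M \<Longrightarrow> dist (X m) (X n) < e / 2"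
      using metric_CauchyD[OF X, of "e / 2"] e by auto
    obtain N where N: "\<And>m n. m \<ge> N \<Longrightarrow> n \<ge> N \<Longrightarrow> dist (U m) (U n) < e / 2"
      using metric_CauchyD[OF LIMSEQ_imp_Cauchy[OF U], of "e / 2"] e by auto
    have "dist (X m - U m) (X n - U n) < e" if "m \<ge> max M N" "n \<ge> max M N" for m n
    proof -
      have "dist (X m - U m) (X n - U n) \<le> dist (X m) (X n) + dist (U m) (U n)"
        unfolding dist_norm using norm_triangle_ineq4[of "X m - X n" "U m - U n"] by (simp add: algebra_simps)
      then show ?thesis using M[of m n] N[of m n] that by auto
    qed
    then show "\<exists>M. \<forall>m\<ge>M. \<forall>n\<ge>M. dist (X m - U m) (X n - U n) < e" by blast
  qed
  then have "Cauchy (\<lambda>k. incl (alg (X k)))" by (simp add: XU)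
  then have "Cauchy (\<lambda>k. alg (X k))" by (simp add: Cauchy_def dist_norm flip: incl_hom)
  then obtain a where "(\<lambda>k. alg (X k)) \<longlonglongrightarrow> a" using Cauchy_convergent unfolding convergent_def by blast
  then have "(\<lambda>k. incl (alg (X k))) \<longlonglongrightarrow> incl a" by (simp add: incl_tendsto_iff)
  from tendsto_add[OF this U] have "X \<longlonglongrightarrow> incl a + Unitization 0 c" by (simp flip: XU)
  then show "convergent X" by (auto simp: convergent_def)
qed

end

section \<open>Transfer of spectrum, positivity and powers to the unitization\<close>

lemma incl_star: "incl (star a) = star (incl a)"
  by (simp add: unitization_eq_iff)

lemma incl_scaleC: "incl (c *\<^sub>C a) = c *\<^sub>C incl a"
  by (simp add: unitization_eq_iff)

lemma incl_selfadjoint_iff: "star (incl a) = incl a \<longleftrightarrow> star a = a"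
  by (simp flip: incl_star)

lemma inv_elem_unitization: "unitization_invertible (a, c) \<longleftrightarrow> inv_elem (Unitization a c)"
proof -
  have "unitization_mult (a, c) (b, d) = (0, 1) \<longleftrightarrow> Unitization a c * Unitization b d = 1" for a b :: 'a and c d
    by (simp add: unitization_mult_def unitization_eq_iff)
  then show ?thesis unfolding unitization_invertible_def inv_elem_def
    by (metis surj_pair unitization.exhaust)
qed

lemma spectrum_eq_usp: "spectrum a = usp (incl a)"
proof -
  have "Unitization a (- z) = incl a - z *\<^sub>C 1" for z by (simp add: unitization_eq_iff)
  then show ?thesis by (simp add: spectrum_def usp_def inv_elem_unitization)
qed

lemma rsp_incl: "{t. complex_of_real t \<in> spectrum a} = rsp (incl a)"
  by (simp add: spectrum_eq_usp rsp_def)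

lemma positive_elements_iff: "a \<in> positive_elements \<longleftrightarrow> pos (incl a)"
proof (cases "star a = a")
  case True
  then have "usp (incl a) = complex_of_real ` rsp (incl a)"
    by (intro usp_eq_rsp) (simp add: incl_selfadjoint_iff)
  with True show ?thesis
    by (auto simp: positive_elements_def pos_def spectrum_eq_usp incl_selfadjoint_iff nonneg_Reals_of_real_iff)
next
  case False
  then show ?thesis by (simp add: positive_elements_def pos_def incl_selfadjoint_iff)
qed

text \<open>\<open>incl a\<close> is killed by the character \<open>scal\<close>. As
  \<open>0\<close> belongs to the spectrum, uniform convergence there includes convergence at
  \<open>0\<close>, which determines the scalar part of \<open>cf f (incl a)\<close>.\<close>

lemma zero_in_rsp_incl: "0 \<in> rsp (incl a)"
proof -
  have "\<not> inv_elem (incl a)"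
  proof
    assume "inv_elem (incl a)"
    then obtain y where "incl a * y = 1" unfolding inv_elem_def by blast
    then have "scal (incl a * y) = 1" by simp
    then show False by simp
  qed
  then show ?thesis by (simp add: rsp_def usp_def)
qed

lemma scal_reval: "scal (reval p (incl a)) = complex_of_real (poly p 0)"
  by (induction p) (simp_all add: reval_simps del: scaleR_conv_of_real)

lemma scal_cf:
  assumes "star a = a" "continuous_on UNIV f"
  shows "scal (cf f (incl a)) = complex_of_real (f 0)"
proof -
  have sa: "star (incl a) = incl a" using assms by (simp add: incl_selfadjoint_iff)
  obtain p where p: "uniform_limit (rsp (incl a)) (\<lambda>k. poly (p k)) f sequentially"
    "(\<lambda>k. reval (p k) (incl a)) \<longlonglongrightarrow> cf f (incl a)" using cf_seq[OF sa assms(2)] by blast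
  have "(\<lambda>k. complex_of_real (poly (p k) 0)) \<longlonglongrightarrow> scal (cf f (incl a))"
    using tendsto_scal[OF p(2)] by (simp add: scal_reval)
  moreover have "(\<lambda>k. complex_of_real (poly (p k) 0)) \<longlonglongrightarrow> complex_of_real (f 0)"
    using tendsto_uniform_limitI[OF p(1) zero_in_rsp_incl] by (intro tendsto_of_real)
  ultimately show ?thesis using LIMSEQ_unique by blast
qed

lemma incl_pow_Suc: "incl (pow_Suc a k) = incl a ^ Suc k"
  by (induction k) (auto simp: incl_hom)

lemma reval_sum: "reval p x = (\<Sum>i\<le>degree p. coeff p i *\<^sub>R x ^ i)"
  by (simp add: reval_def uev_def degree_map_poly coeff_map_poly scaleC_of_real)

lemma incl_poly_apply:
  assumes "poly p 0 = 0"
  shows "incl (poly_apply p a) = reval p (incl a)"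
  using assms
  by (simp add: poly_apply_def reval_sum incl_sum incl_hom incl_pow_Suc sum.atMost_shift poly_0_coeff_0)

lemma incl_cfc:
  assumes sa: "star a = a" and f: "continuous_on UNIV f" "f 0 = 0"
  shows "incl (cfc f a) = cf f (incl a)"
proof -
  have sa': "star (incl a) = incl a" using sa by (simp add: incl_selfadjoint_iff)
  define b where "b = alg (cf f (incl a))"
  have b: "incl b = cf f (incl a)" unfolding b_def using scal_cf[OF sa f(1)] f(2) by (intro incl_alg) simp
  let ?P = "\<lambda>b. \<forall>p. (\<forall>k. poly (p k) 0 = 0) \<longrightarrow>
      uniform_limit {t. complex_of_real t \<in> spectrum a} (\<lambda>k. poly (p k)) f sequentially \<longrightarrow>
      (\<lambda>k. poly_apply (p k) a) \<longlonglongrightarrow> b"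
  have P: "?P b"
  proof (intro allI impI)
    fix p :: "nat \<Rightarrow> real poly"
    assume p: "\<forall>k. poly (p k) 0 = 0"
      "uniform_limit {t. complex_of_real t \<in> spectrum a} (\<lambda>k. poly (p k)) f sequentially"
    have "(\<lambda>k. reval (p k) (incl a)) \<longlonglongrightarrow> cf f (incl a)"
      using p(2) unfolding rsp_incl by (rule cf_LIMSEQ[OF sa' f(1)])
    then have "(\<lambda>k. incl (poly_apply (p k) a)) \<longlonglongrightarrow> incl b" using p(1) by (simp add: incl_poly_apply b)
    then show "(\<lambda>k. poly_apply (p k) a) \<longlonglongrightarrow> b" by (simp add: incl_tendsto_iff)
  qed
  obtain p where p: "uniform_limit (rsp (incl a)) (\<lambda>k. poly (p k)) f sequentially"
    using cf_seq[OF sa' f(1)] by blast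
  \<comment> \<open>Subtracting the constants, which tend to \<open>f 0 = 0\<close>, gives a
    sequence admissible in the definition of \<open>cfc\<close>. One such sequence must exist for
    the described element to be unique.\<close>
  define p' where "p' k = p k - [:poly (p k) 0:]" for k
  have "(\<lambda>k. poly (p k) 0) \<longlonglongrightarrow> f 0" by (rule tendsto_uniform_limitI[OF p zero_in_rsp_incl])
  then have "uniform_limit (rsp (incl a)) (\<lambda>k t. poly (p k) 0) (\<lambda>t. f 0) sequentially"
    by (auto simp: uniform_limit_iff tendsto_iff)
  from uniform_limit_minus[OF p this] have p': "uniform_limit (rsp (incl a)) (\<lambda>k. poly (p' k)) f sequentially"
    by (simp add: p'_def f(2) poly_diff[abs_def])
  have "cfc f a = b"
    unfolding cfc_def
  proof (rule the_equality[of ?P])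
    show "?P b" by (rule P)
    fix b' assume "?P b'"
    then have "(\<lambda>k. poly_apply (p' k) a) \<longlonglongrightarrow> b'" using p' by (simp add: rsp_incl p'_def)
    moreover have "(\<lambda>k. poly_apply (p' k) a) \<longlonglongrightarrow> b" using P p' by (simp add: rsp_incl p'_def)
    ultimately show "b' = b" using LIMSEQ_unique by blast
  qed
  then show ?thesis using b by simp
qed

lemma positive_selfadjoint: "a \<in> positive_elements \<Longrightarrow> star a = a"
  by (simp add: positive_elements_def)

text \<open>The function \<open>\<lambda>t. t powr s\<close> is only relevant for \<open>t \<ge> 0\<close>; truncating it makes it continuous
  on the whole line.\<close>

lemma incl_positive_powr:
  assumes a: "a \<in> positive_elements" and s: "s > 0"
  shows "incl (positive_powr a s) = cf (\<lambda>t. max t 0 powr s) (incl a)"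
proof -
  have "t \<ge> 0" if "complex_of_real t \<in> spectrum a" for t
    using that a by (auto simp: positive_elements_def)
  then have "uniform_limit {t. complex_of_real t \<in> spectrum a} (\<lambda>k. poly (p k)) (\<lambda>t. t powr s) sequentially
    \<longleftrightarrow> uniform_limit {t. complex_of_real t \<in> spectrum a} (\<lambda>k. poly (p k)) (\<lambda>t. max t 0 powr s) sequentially"
    for p by (intro uniform_limit_cong') auto
  then have "positive_powr a s = cfc (\<lambda>t. max t 0 powr s) a"
    unfolding positive_powr_def cfc_def by simp
  then show ?thesis
    using incl_cfc[OF positive_selfadjoint[OF a] continuous_on_max_powr[OF s]] s by simp
qed

lemma positive_powr_positive:
  assumes "a \<in> positive_elements" "s > 0"
  shows "positive_powr a s \<in> positive_elements"
  unfolding positive_elements_iff incl_positive_powr[OF assms]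
  using assms by (intro pos_cf continuous_on_max_powr) (auto simp: positive_elements_iff pos_def)

lemma incl_positive_powr_nat:
  assumes a: "a \<in> positive_elements" and n: "n \<ge> 1"
  shows "incl (positive_powr a (real n)) = incl a ^ n"
proof -
  have p: "pos (incl a)" using a by (simp add: positive_elements_iff)
  note sa = pos_selfadjoint[OF p]
  have "cf (\<lambda>t. max t 0 powr real n) (incl a) = cf (\<lambda>t. t ^ n) (incl a)"
  proof (rule cf_cong[OF sa])
    fix t assume "t \<in> rsp (incl a)"
    then have "t \<ge> 0" using p by (simp add: pos_def)
    then show "max t 0 powr real n = t ^ n"
      using n by (cases "t = 0") (auto simp: powr_realpow)
  qed
  then show ?thesis using a n by (simp add: incl_positive_powr cf_power[OF sa])
qed

lemma positive_powr_root:
  assumes a: "a \<in> positive_elements" and n: "n \<ge> 1"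
  shows "positive_powr (positive_powr a (real n)) (1 / real n) = a"
proof -
  have p: "pos (incl a)" using a by (simp add: positive_elements_iff)
  note sa = pos_selfadjoint[OF p]
  have "incl (positive_powr (positive_powr a (real n)) (1 / real n))
      = cf (\<lambda>t. max t 0 powr (1 / real n)) (cf (\<lambda>t. t ^ n) (incl a))"
    using incl_positive_powr[OF positive_powr_positive[OF a], of "real n" "1 / real n"] n
    by (simp add: incl_positive_powr_nat[OF a n] cf_power[OF sa])
  also have "\<dots> = cf (\<lambda>t. max (t ^ n) 0 powr (1 / real n)) (incl a)"
    using n by (intro cf_comp[OF sa] continuous_on_max_powr continuous_intros) auto
  also have "\<dots> = cf (\<lambda>t. t) (incl a)"
  proof (rule cf_cong[OF sa])
    fix t assume "t \<in> rsp (incl a)"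
    then have "t \<ge> 0" using p by (simp add: pos_def)
    then show "max (t ^ n) 0 powr (1 / real n) = t"
      using n by (cases "t = 0") (auto simp: powr_powr simp flip: powr_realpow)
  qed
  also have "\<dots> = incl a" by (rule cf_ident[OF sa])
  finally show ?thesis by simp
qed

lemma cstar_le_iff: "cstar_le a b \<longleftrightarrow> pos (incl b - incl a)"
  by (simp add: cstar_le_def positive_elements_iff incl_hom)

section \<open>Dixmier ideals\<close>

context
  fixes J :: "'a::cstar_algebra set"
  assumes J: "dixmier_ideal J"
begin

lemma dixmier_positive: "a \<in> positive_part J \<Longrightarrow> pos (incl a)"
  by (simp add: positive_part_def positive_elements_iff)

lemma dixmier_scaleR:
  assumes "a \<in> positive_part J" "r \<ge> 0"
  shows "r *\<^sub>R a \<in> positive_part J"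
proof -
  have "complex_of_real r *\<^sub>C a \<in> cspan (positive_part J)"
    using assms by (intro cvec.span_scale cvec.span_base)
  then have "r *\<^sub>R a \<in> J" using J by (simp add: dixmier_ideal_def scaleC_of_real)
  moreover have "pos (incl (r *\<^sub>R a))"
    unfolding incl_hom using assms by (intro pos_scaleR dixmier_positive)
  ultimately show ?thesis by (simp add: positive_part_def positive_elements_iff)
qed

lemma dixmier_hereditary:
  assumes "b \<in> positive_part J" "pos (incl a)" "pos (incl b - incl a)"
  shows "a \<in> positive_part J"
  using J assms unfolding dixmier_ideal_def order_ideal_def
  by (metis cstar_le_iff positive_elements_iff dixmier_positive)

lemma dixmier_sum:
  assumes "\<And>i. i \<in> S \<Longrightarrow> f i \<in> positive_part J"
  shows "sum f S \<in> positive_part J"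
  using assms J unfolding dixmier_ideal_def order_ideal_def
  by (induction S rule: infinite_finite_induct) auto

lemma dixmier_strongly_invariant: "x * star x \<in> positive_part J \<Longrightarrow> star x * x \<in> positive_part J"
  using J by (simp add: dixmier_ideal_def strongly_invariant_def)

text \<open>Strong invariance moves each \<open>star y * y\<close> into \<open>J\<close>, so the
  root of the dominating sum lies in \<open>J\<close>; Loewner-Heinz and heredity pass this on to
  the root of \<open>b\<close>.\<close>

lemma root_of_sum_powers_mem:
  assumes S: "finite S" and a: "\<And>i. i \<in> S \<Longrightarrow> a i \<in> positive_part J" and n: "n \<ge> 1"
    and b: "b \<in> positive_elements" and le: "pos ((\<Sum>i\<in>S. incl (a i) ^ n) - incl b)"
  shows "positive_powr b (1 / real n) \<in> positive_part J"
proof -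
  define c where "c = (\<Sum>i\<in>S. incl (a i) ^ n)"
  define q where "q = (1 - 1 / real n) / 2"
  have pa: "pos (incl (a i))" if "i \<in> S" for i using a[OF that] by (rule dixmier_positive)
  obtain y where y:
    "\<And>i. i \<in> S \<Longrightarrow> (\<lambda>k. half_power (incl (a i)) n * cf (pw (1 / real (Suc k)) (- q)) c) \<longlonglongrightarrow> y i"
    "\<And>i. i \<in> S \<Longrightarrow> pos (y i * star (y i))"
    "\<And>i. i \<in> S \<Longrightarrow> pos (2 *\<^sub>R incl (a i) - y i * star (y i))"
    "cf (\<lambda>t. max t 0 powr (1 / real n)) c = (\<Sum>i\<in>S. star (y i) * y i)"
    using root_sum_powers[OF S pa n c_def q_def] by blast
  \<comment> \<open>The half power has scalar part \<open>sqrt (0 ^ n) = 0\<close>, hence so do its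
    products and their limit: \<open>y i\<close> comes from the algebra itself, where strong
    invariance of \<open>J\<close> is available.\<close>
  have ey: "incl (alg (y i)) = y i" if i: "i \<in> S" for i
  proof (rule incl_alg)
    have "scal (half_power (incl (a i)) n) = complex_of_real (sqrt (max 0 0 ^ n))"
      unfolding half_power_def using a[OF i]
      by (intro scal_cf positive_selfadjoint continuous_intros) (simp add: positive_part_def)
    then have "(\<lambda>k. 0) \<longlonglongrightarrow> scal (y i)" using tendsto_scal[OF y(1)[OF i]] n by (simp add: zero_power)
    then show "scal (y i) = 0" using LIMSEQ_unique tendsto_const by blast
  qed
  have "star (alg (y i)) * alg (y i) \<in> positive_part J" if i: "i \<in> S" for i
  proof (rule dixmier_strongly_invariant, rule dixmier_hereditary)
    show "2 *\<^sub>R a i \<in> positive_part J" using a[OF i] by (rule dixmier_scaleR) simp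
    show "pos (incl (alg (y i) * star (alg (y i))))"
      "pos (incl (2 *\<^sub>R a i) - incl (alg (y i) * star (alg (y i))))"
      using y(2,3)[OF i] by (simp_all only: incl_hom incl_star ey[OF i])
  qed
  then have root: "(\<Sum>i\<in>S. star (alg (y i)) * alg (y i)) \<in> positive_part J" by (rule dixmier_sum)
  have "incl (\<Sum>i\<in>S. star (alg (y i)) * alg (y i)) = cf (\<lambda>t. max t 0 powr (1 / real n)) c"
    unfolding y(4) incl_sum by (intro sum.cong refl) (simp only: incl_hom incl_star ey)
  moreover have "pos (cf (\<lambda>t. max t 0 powr (1 / real n)) c - cf (\<lambda>t. max t 0 powr (1 / real n)) (incl b))"
    using b le n unfolding c_def by (intro Loewner_Heinz) (auto simp: positive_elements_iff)
  ultimately show ?thesis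
    using b n positive_powr_positive[OF b, of "1 / real n"]
    by (intro dixmier_hereditary[OF root]) (simp_all add: incl_positive_powr positive_elements_iff)
qed

text \<open>Since \<open>b\<close> is self-adjoint, averaging a complex combination with its adjoint
  leaves only the real parts of the coefficients; replacing these by absolute values gives a sum of
  powers dominating \<open>b\<close>.\<close>

lemma ideal_powr_root_mem:
  assumes n: "n \<ge> 1" and b: "b \<in> positive_elements" "b \<in> ideal_powr J (real n)"
  shows "positive_powr b (1 / real n) \<in> positive_part J"
proof -
  obtain T r where T: "finite T" "T \<subseteq> (\<lambda>a. positive_powr a (real n)) ` positive_part J"
    and bsum: "b = (\<Sum>x\<in>T. r x *\<^sub>C x)"
    using b(2) unfolding ideal_powr_def cvec.span_explicit by blast
  from T(2) have "\<forall>x\<in>T. \<exists>a. a \<in> positive_part J \<and> x = positive_powr a (real n)" by blast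
  from bchoice[OF this] obtain g
    where g: "\<And>x. x \<in> T \<Longrightarrow> g x \<in> positive_part J \<and> x = positive_powr (g x) (real n)" by blast
  have x: "incl x = incl (g x) ^ n" "pos (incl (g x))" "pos (incl x)" if "x \<in> T" for x
  proof -
    have gx: "g x \<in> positive_elements" "x = positive_powr (g x) (real n)"
      using g[OF that] by (auto simp: positive_part_def)
    show "incl x = incl (g x) ^ n"
      by (subst gx(2)) (rule incl_positive_powr_nat[OF gx(1) n])
    moreover show "pos (incl (g x))" using gx(1) by (simp add: positive_elements_iff)
    ultimately show "pos (incl x)" by (simp add: pos_power)
  qed
  \<comment> \<open>The root of the coefficient is absorbed into the element, so that the
    \<open>n\<close>-th power reproduces \<open>\<bar>Re (r x)\<bar>\<close>.\<close>
  define a where "a x = (\<bar>Re (r x)\<bar> powr (1 / real n)) *\<^sub>R g x" for x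
  have an: "incl (a x) ^ n = \<bar>Re (r x)\<bar> *\<^sub>R incl x" if "x \<in> T" for x
  proof -
    have "(\<bar>Re (r x)\<bar> powr (1 / real n)) ^ n = \<bar>Re (r x)\<bar>"
      using n by (cases "Re (r x) = 0") (simp_all add: powr_powr flip: powr_realpow)
    then show ?thesis using x(1)[OF that] by (simp add: a_def incl_hom scaleR_power)
  qed
  have "incl b = (1/2) *\<^sub>R (incl b + star (incl b))"
    using positive_selfadjoint[OF b(1)] incl_selfadjoint_iff[of b] by (simp flip: scaleR_2)
  also have "\<dots> = (\<Sum>x\<in>T. (1/2) *\<^sub>R (r x *\<^sub>C incl x + star (r x *\<^sub>C incl x)))"
    by (simp add: bsum incl_sum incl_scaleC star_sum sum.distrib scaleR_sum_right scaleR_add_right)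
  also have "\<dots> = (\<Sum>x\<in>T. Re (r x) *\<^sub>R incl x)"
  proof (intro sum.cong refl)
    fix z assume "z \<in> T"
    then have "r z *\<^sub>C incl z + star (r z *\<^sub>C incl z) = (r z + cnj (r z)) *\<^sub>C incl z"
      using pos_selfadjoint[OF x(3)] by (simp add: star_scaleC scaleC_add_left)
    also have "r z + cnj (r z) = complex_of_real (2 * Re (r z))" by (simp add: complex_add_cnj)
    finally show "(1/2) *\<^sub>R (r z *\<^sub>C incl z + star (r z *\<^sub>C incl z)) = Re (r z) *\<^sub>R incl z"
      by (simp only: scaleC_of_real) simp
  qed
  finally have "(\<Sum>x\<in>T. incl (a x) ^ n) - incl b = (\<Sum>x\<in>T. (\<bar>Re (r x)\<bar> - Re (r x)) *\<^sub>R incl x)"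
    by (simp add: an sum_subtractf scaleR_diff_left)
  moreover have "pos (\<Sum>x\<in>T. (\<bar>Re (r x)\<bar> - Re (r x)) *\<^sub>R incl x)"
    using x(3) by (intro pos_sum pos_scaleR) auto
  ultimately have "pos ((\<Sum>x\<in>T. incl (a x) ^ n) - incl b)" by simp
  moreover have "a x \<in> positive_part J" if "x \<in> T" for x
    unfolding a_def using g[OF that] by (intro dixmier_scaleR) auto
  ultimately show ?thesis by (intro root_of_sum_powers_mem[OF T(1) _ n b(1)]) auto
qed

end

theorem corollary3p11:
  fixes I J :: "'a::cstar_algebra set" and n :: nat
  assumes "dixmier_ideal I"
    and "n \<ge> 1"
    and "dixmier_ideal J"
    and "ideal_powr J (real n) = I"
  shows "J = ideal_powr I (1 / real n)"
proof
  have span: "J = cspan (positive_part J)" using assms(3) by (simp add: dixmier_ideal_def)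
  have "positive_part J \<subseteq> ideal_powr I (1 / real n)"
  proof
    fix a assume a: "a \<in> positive_part J"
    then have pa: "a \<in> positive_elements" by (simp add: positive_part_def)
    have "positive_powr a (real n) \<in> ideal_powr J (real n)"
      unfolding ideal_powr_def using a by (intro cvec.span_base imageI)
    then have "positive_powr a (real n) \<in> positive_part I"
      using assms(2,4) positive_powr_positive[OF pa] by (simp add: positive_part_def)
    then have "positive_powr (positive_powr a (real n)) (1 / real n) \<in> ideal_powr I (1 / real n)"
      unfolding ideal_powr_def by (intro cvec.span_base imageI)
    then show "a \<in> ideal_powr I (1 / real n)" by (simp add: positive_powr_root[OF pa assms(2)])
  qed
  then show "J \<subseteq> ideal_powr I (1 / real n)"
    unfolding ideal_powr_def by (subst span) (rule cvec.span_minimal[OF _ cvec.subspace_span])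
  have "(\<lambda>a. positive_powr a (1 / real n)) ` positive_part I \<subseteq> positive_part J"
    using ideal_powr_root_mem[OF assms(3,2)] assms(4) by (auto simp: positive_part_def)
  then show "ideal_powr I (1 / real n) \<subseteq> J"
    unfolding ideal_powr_def by (subst span) (rule cvec.span_mono)
qed

end
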